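(* Let $\Gamma$ be a finite, undirected, simple, connected graph, let $G \le \operatorname{Aut}(\Gamma)$, and suppose $\Gamma$ is $G$-arc-transitive and contains a $G$-permutable $m$-matching. Then the degree of $\Gamma$ is at least $m$, unless $m = 3$ and $\Gamma$ is the cycle $C_{3k}$ for some $k \ge 2$.
   Context: A matching is a set of edges no two of which share a vertex. For $G \le \operatorname{Aut}(\Gamma)$, a matching $\mathcal{M}$ with $m$ edges is a $G$-permutable $m$-matching if the setwise stabilizer $G_{\mathcal{M}}$ of $\mathcal{M}$ in $G$ induces the full symmetric group $S_m$ on the set of $m$ edges of $\mathcal{M}$. $\Gamma$ is $G$-arc-transitive if $G$ is transitive on ordered pairs of adjacent vertices. *)

theory Defs
  imports "Graph_Theory.Graph_Theory" "HOL-Algebra.Bij"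
begin

text \<open>
  A finite simple undirected graph is a \<^locale>\<open>pair_graph\<close>: every edge is represented by its two
  opposite arcs, so \<^const>\<open>parcs\<close> is the set of ordered pairs of adjacent vertices, and the degree
  of a vertex is its \<^const>\<open>out_degree\<close>.
\<close>

definition graph_edges :: "'a pair_pre_digraph \<Rightarrow> 'a set set" where
  "graph_edges \<Gamma> = {{u, v} | u v. (u, v) \<in> parcs \<Gamma>}"

definition graph_auts :: "'a pair_pre_digraph \<Rightarrow> ('a \<Rightarrow> 'a) set" where
  "graph_auts \<Gamma> = {f \<in> Bij (pverts \<Gamma>).
     \<forall>u \<in> pverts \<Gamma>. \<forall>v \<in> pverts \<Gamma>. (f u, f v) \<in> parcs \<Gamma> \<longleftrightarrow> (u, v) \<in> parcs \<Gamma>}"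

definition AutGraph :: "'a pair_pre_digraph \<Rightarrow> ('a \<Rightarrow> 'a) monoid" where
  "AutGraph \<Gamma> = BijGroup (pverts \<Gamma>) \<lparr>carrier := graph_auts \<Gamma>\<rparr>"

lemma subgroup_graph_auts: "subgroup (graph_auts \<Gamma>) (BijGroup (pverts \<Gamma>))"
proof (rule subgroup.intro)
  show "graph_auts \<Gamma> \<subseteq> carrier (BijGroup (pverts \<Gamma>))"
    by (auto simp: graph_auts_def BijGroup_def)
next
  fix f g assume "f \<in> graph_auts \<Gamma>" "g \<in> graph_auts \<Gamma>"
  then show "f \<otimes>\<^bsub>BijGroup (pverts \<Gamma>)\<^esub> g \<in> graph_auts \<Gamma>"
    using Bij_imp_funcset[of g "pverts \<Gamma>"]
    by (auto simp: graph_auts_def BijGroup_def compose_Bij compose_eq Pi_iff)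
next
  show "\<one>\<^bsub>BijGroup (pverts \<Gamma>)\<^esub> \<in> graph_auts \<Gamma>"
    by (auto simp: graph_auts_def BijGroup_def id_Bij)
next
  fix f assume f: "f \<in> graph_auts \<Gamma>"
  then have fB: "f \<in> Bij (pverts \<Gamma>)" by (simp add: graph_auts_def)
  then have r: "f (inv_into (pverts \<Gamma>) f x) = x" if "x \<in> pverts \<Gamma>" for x
    using that by (auto simp: Bij_def bij_betw_def intro: f_inv_into_f)
  show "inv\<^bsub>BijGroup (pverts \<Gamma>)\<^esub> f \<in> graph_auts \<Gamma>"
    unfolding inv_BijGroup[OF fB] graph_auts_def
  proof (intro CollectI conjI ballI restrict_inv_into_Bij[OF fB])
    fix u v assume uv: "u \<in> pverts \<Gamma>" "v \<in> pverts \<Gamma>"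
    let ?i = "inv_into (pverts \<Gamma>) f"
    have "(f (?i u), f (?i v)) \<in> parcs \<Gamma> \<longleftrightarrow> (?i u, ?i v) \<in> parcs \<Gamma>"
      using f uv Bij_inv_into_mem[OF fB] by (simp add: graph_auts_def)
    then show "(restrict ?i (pverts \<Gamma>) u, restrict ?i (pverts \<Gamma>) v) \<in> parcs \<Gamma> \<longleftrightarrow> (u, v) \<in> parcs \<Gamma>"
      using uv r by simp
  qed
qed

lemma group_AutGraph: "group (AutGraph \<Gamma>)"
  unfolding AutGraph_def
  by (rule subgroup.subgroup_is_group[OF subgroup_graph_auts group_BijGroup])

definition arc_transitive :: "('a \<Rightarrow> 'a) set \<Rightarrow> 'a pair_pre_digraph \<Rightarrow> bool" where
  "arc_transitive G \<Gamma> \<longleftrightarrow>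
     (\<forall>(u, v) \<in> parcs \<Gamma>. \<forall>(x, y) \<in> parcs \<Gamma>. \<exists>g \<in> G. g u = x \<and> g v = y)"

definition matching :: "'a pair_pre_digraph \<Rightarrow> 'a set set \<Rightarrow> bool" where
  "matching \<Gamma> M \<longleftrightarrow> M \<subseteq> graph_edges \<Gamma> \<and> (\<forall>e \<in> M. \<forall>e' \<in> M. e \<noteq> e' \<longrightarrow> e \<inter> e' = {})"

definition setwise_stabilizer :: "('a \<Rightarrow> 'a) set \<Rightarrow> 'a set set \<Rightarrow> ('a \<Rightarrow> 'a) set" where
  "setwise_stabilizer G M = {g \<in> G. (\<lambda>e. g ` e) ` M = M}"

definition permutable_matching ::
    "('a \<Rightarrow> 'a) set \<Rightarrow> 'a pair_pre_digraph \<Rightarrow> nat \<Rightarrow> 'a set set \<Rightarrow> bool" where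
  "permutable_matching G \<Gamma> m M \<longleftrightarrow>
     matching \<Gamma> M \<and> finite M \<and> card M = m \<and>
     (\<lambda>g. \<lambda>e \<in> M. g ` e) ` setwise_stabilizer G M = carrier (BijGroup M)"

text \<open>The cycle with \<open>n\<close> vertices, for \<open>n \<ge> 3\<close>.\<close>

definition cycle_graph :: "nat \<Rightarrow> nat pair_pre_digraph" where
  "cycle_graph n = \<lparr>pverts = {..<n},
     parcs = {(i, j). i < n \<and> j < n \<and> (j = (i + 1) mod n \<or> i = (j + 1) mod n)}\<rparr>"

lemma pair_graph_cycle_graph:
  assumes "n \<ge> 3"
  shows "pair_graph (cycle_graph n)"
proof
  show "finite (parcs (cycle_graph n))"
    by (rule finite_subset[of _ "{..<n} \<times> {..<n}"]) (auto simp: cycle_graph_def)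
next
  fix e assume "e \<in> parcs (cycle_graph n)"
  then show "fst e \<noteq> snd e"
    using assms by (cases "fst e + 1 = n") (auto simp: cycle_graph_def)
qed (auto simp: cycle_graph_def symmetric_def intro: symI)

end

theory Submission
  imports Defs "HOL-Combinatorics.Permutations"
begin

text \<open>
  Suppose the degree \<open>d\<close> is smaller than \<open>m\<close>, let \<open>{v, w}\<close> be an edge of the matching and let \<open>H\<close> be
  the subgroup of the stabilizer of the matching that fixes \<open>v\<close> and \<open>w\<close>. It induces at least the
  alternating group on the other \<open>n = m - 1\<close> edges. A subgroup fixing two adjacent vertices \<open>x\<close>, \<open>y\<close>
  acts on the at most \<open>n - 1\<close> neighbours of \<open>x\<close> other than \<open>y\<close>. If \<open>n \<ge> 5\<close>, then simplicity of the
  alternating group and comparison of orders show that the kernel of this action still induces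
  the alternating group; walking through the connected graph, so does the trivial group,
  a contradiction. If \<open>d \<le> 3\<close>, or if no arc stabilizer induces a three-cycle on a neighbourhood,
  the same walk shows that arc stabilizers are 2-groups, so \<open>n \<le> 2\<close>. There remains
  \<open>m = 5\<close>, \<open>d = 4\<close>: by the Thompson--Wielandt argument the pointwise stabilizer of the neighbourhoods
  of \<open>v\<close> and \<open>w\<close> is a 3-group, so that arc stabilizers have normal Sylow 3-subgroups and hence do
  not have the alternating group of degree four as a section. For \<open>m = 3\<close>, \<open>d = 2\<close> the graph is a
  cycle on which an element of order three acts without fixed vertices.
\<close>

section \<open>Groups of permutations\<close>

text \<open>The simplicity argument breaks down for n = 4: the alternating group of degree four maps
  onto a group of order three, which acts faithfully on the three remaining neighbours, so the
  kernel may keep only the Klein four-group. Excluding this is the purpose of the Thompson--Wielandt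
  part. Only the primes 2 and 3 matter there, since an arc stabilizer acts on the three other
  neighbours inside the symmetric group of degree three; hence some power of 6 annihilates each of
  its elements. The final contradiction comes from a single element. A commutator of elements
  inducing (a b c) and (b c d) on matching edges induces a double transposition. On three points
  every commutator has trivial cube, so the cube of this one fixes the neighbourhoods of both
  \<open>v\<close> and \<open>w\<close>; its 2-part is then trivial, and the commutator has 3-power
  order although it swaps two edges.\<close>

abbreviation Inv :: "('a \<Rightarrow> 'a) \<Rightarrow> 'a \<Rightarrow> 'a" where
  "Inv f \<equiv> inv_into UNIV f"

text \<open>Permutations are total functions on the type, so that products are plain composition and
  inverses are \<open>Inv\<close>, with no carrier to restrict to.\<close>

definition perm_group :: "('a \<Rightarrow> 'a) set \<Rightarrow> bool" where
  "perm_group L \<longleftrightarrow> id \<in> L \<and> (\<forall>f\<in>L. \<forall>g\<in>L. f \<circ> g \<in> L) \<and> (\<forall>f\<in>L. Inv f \<in> L) \<and> (\<forall>f\<in>L. bij f)"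

definition normal_sub :: "('a \<Rightarrow> 'a) set \<Rightarrow> ('a \<Rightarrow> 'a) set \<Rightarrow> bool" where
  "normal_sub N L \<longleftrightarrow> perm_group N \<and> N \<subseteq> L \<and> (\<forall>g\<in>L. \<forall>h\<in>N. g \<circ> h \<circ> Inv g \<in> N)"

text \<open>All p-groups are described elementwise through this predicate, so that Sylow subgroups
  never have to be formed; coprimality enters through Bezout's identity.\<close>

definition p_elem :: "nat \<Rightarrow> ('a \<Rightarrow> 'a) \<Rightarrow> bool" where
  "p_elem p f \<longleftrightarrow> (\<exists>k. f ^^ (p ^ k) = id)"

definition commut :: "('a \<Rightarrow> 'a) \<Rightarrow> ('a \<Rightarrow> 'a) \<Rightarrow> 'a \<Rightarrow> 'a" where
  "commut f g = f \<circ> g \<circ> Inv f \<circ> Inv g"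

lemma bij_Inv [simp]:
  assumes "bij f"
  shows "f (Inv f x) = x" "Inv f (f x) = x" "bij (Inv f)" "f \<circ> Inv f = id" "Inv f \<circ> f = id"
  using assms by (auto simp: bij_is_surj surj_f_inv_f bij_is_inj inv_f_f bij_imp_bij_inv fun_eq_iff)

lemma Inv_eq_iff: "bij f \<Longrightarrow> Inv f x = y \<longleftrightarrow> x = f y"
  by (metis bij_Inv(1,2))

lemma perm_groupD:
  assumes "perm_group L"
  shows "id \<in> L" "f \<in> L \<Longrightarrow> g \<in> L \<Longrightarrow> f \<circ> g \<in> L" "f \<in> L \<Longrightarrow> Inv f \<in> L" "f \<in> L \<Longrightarrow> bij f"
  using assms by (auto simp: perm_group_def)

lemma perm_group_funpow: "perm_group L \<Longrightarrow> f \<in> L \<Longrightarrow> f ^^ n \<in> L"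
  by (induction n) (auto simp: perm_group_def)

lemma perm_group_conj: "perm_group L \<Longrightarrow> f \<in> L \<Longrightarrow> g \<in> L \<Longrightarrow> f \<circ> g \<circ> Inv f \<in> L"
  by (auto simp: perm_group_def)

lemma perm_group_commut: "perm_group L \<Longrightarrow> f \<in> L \<Longrightarrow> g \<in> L \<Longrightarrow> commut f g \<in> L"
  by (auto simp: perm_group_def commut_def)

lemma Inv_fix: "bij f \<Longrightarrow> f x = x \<Longrightarrow> Inv f x = x"
  by (metis bij_Inv(2))

lemma perm_group_subset:
  assumes "perm_group L" "id \<in> S" "S \<subseteq> L" "\<And>f g. f \<in> S \<Longrightarrow> g \<in> S \<Longrightarrow> f \<circ> g \<in> S" "\<And>f. f \<in> S \<Longrightarrow> Inv f \<in> S"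
  shows "perm_group S"
  using assms by (auto simp: perm_group_def)

lemma perm_group_stab: "perm_group L \<Longrightarrow> perm_group {f \<in> L. \<forall>x\<in>S. f x = x}"
  by (rule perm_group_subset[of L]) (auto simp: perm_group_def Inv_fix)

lemma funpow_fix: "f x = x \<Longrightarrow> (f ^^ n) x = x"
  by (induction n) auto

lemma funpow_mult': "((f :: 'a \<Rightarrow> 'a) ^^ m) ^^ n = f ^^ (m * n)"
  by (induction n) (auto simp: funpow_add algebra_simps)

lemma conj_comp: "bij r \<Longrightarrow> (r \<circ> f \<circ> Inv r) \<circ> (r \<circ> g \<circ> Inv r) = r \<circ> (f \<circ> g) \<circ> Inv r"
  by (simp add: fun_eq_iff)

lemma conj_funpow: "bij r \<Longrightarrow> (r \<circ> f \<circ> Inv r) ^^ n = r \<circ> f ^^ n \<circ> Inv r"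
  by (induction n) (auto simp: fun_eq_iff)

lemma conj_Inv:
  assumes "bij r" "bij f" shows "Inv (r \<circ> f \<circ> Inv r) = r \<circ> Inv f \<circ> Inv r"
proof -
  have "bij (r \<circ> f \<circ> Inv r)" using assms by (auto intro!: bij_comp)
  then show ?thesis using assms by (simp add: fun_eq_iff Inv_eq_iff)
qed

lemma conj_id_iff: "bij r \<Longrightarrow> r \<circ> f \<circ> Inv r = id \<longleftrightarrow> f = id"
  by (auto simp: fun_eq_iff) (metis bij_Inv(2))

lemma p_elem_conj: "bij r \<Longrightarrow> p_elem p f \<Longrightarrow> p_elem p (r \<circ> f \<circ> Inv r)"
  unfolding p_elem_def by (metis conj_funpow conj_id_iff)

text \<open>By Bezout, \<open>f ^^ (p * a)\<close> is \<open>f ^^ (q * b)\<close> followed by one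
  more \<open>f\<close>, and both powers fix \<open>x\<close>. It serves for the action on vertices
  and, through the image map, for the action on edges.\<close>

lemma funpow_coprime_fix:
  assumes "coprime p q" "(f ^^ p) x = x" "(f ^^ q) x = x"
  shows "f x = x"
proof (cases "p = 0 \<or> q = 0")
  case True
  then show ?thesis using assms by auto
next
  case False
  then obtain a b where "p * a = q * b + 1"
    using bezout_nat[of p q] assms(1) by auto
  moreover have "(f ^^ (p * a)) x = x" "(f ^^ (q * b)) x = x"
    using assms(2,3) by (simp_all flip: funpow_mult' add: funpow_fix)
  ultimately show ?thesis by simp
qed

lemma p_elem_fix:
  assumes "p_elem p f" "(f ^^ q) x = x" "coprime p q"
  shows "f x = x"
proof -
  obtain k where "f ^^ (p ^ k) = id" using assms(1) by (auto simp: p_elem_def)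
  then show ?thesis using assms funpow_coprime_fix[of "p ^ k" q f x] by simp
qed

text \<open>An element of p-power order is itself a power of \<open>f ^^ q\<close>, again by
  Bezout.\<close>

lemma p_elem_in_group:
  assumes "perm_group L" "p_elem p f" "f ^^ q \<in> L" "coprime p q"
  shows "f \<in> L"
proof -
  obtain k where k: "f ^^ (p ^ k) = id" using assms(2) by (auto simp: p_elem_def)
  show ?thesis
  proof (cases "q = 0 \<or> p ^ k = 0")
    case True
    \<comment> \<open>Degenerate exponents: \<open>q = 0\<close> forces \<open>p = 1\<close> and
      hence \<open>f = id\<close>, while \<open>p = 0\<close> forces \<open>q = 1\<close>, so that
      \<open>f ^^ q\<close> is \<open>f\<close>.\<close>
    then have "p = 1 \<or> (p = 0 \<and> q = 1)" using assms(4) by auto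
    then show ?thesis using k assms perm_groupD(1)[OF assms(1)] by auto
  next
    case False
    then obtain a b where ab: "q * a = p ^ k * b + 1"
      using bezout_nat[of q "p ^ k"] assms(4) by (auto simp: coprime_commute)
    have "f ^^ (q * a) = f \<circ> f ^^ (p ^ k * b)" unfolding ab by simp
    also have "f ^^ (p ^ k * b) = id"
      using k by (simp flip: funpow_mult' add: id_def funpow_fix fun_eq_iff)
    finally have "f = (f ^^ q) ^^ a" by (simp add: funpow_mult')
    then show ?thesis using perm_group_funpow[OF assms(1,3)] by metis
  qed
qed

text \<open>Carrying the factors from \<open>N\<close> to the left past \<open>f\<close> only
  conjugates them. This is computation modulo \<open>N\<close> without quotient groups.\<close>

lemma funpow_comp_normalized:
  assumes "perm_group N" "g \<in> N" "bij f" "\<And>h. h \<in> N \<Longrightarrow> f \<circ> h \<circ> Inv f \<in> N"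
  shows "\<exists>h\<in>N. (f \<circ> g) ^^ n = h \<circ> f ^^ n"
proof (induction n)
  case 0
  then show ?case using perm_groupD(1)[OF assms(1)] by (intro bexI[of _ id]) auto
next
  case (Suc n)
  then obtain h where h: "h \<in> N" "(f \<circ> g) ^^ n = h \<circ> f ^^ n" by blast
  have "(f \<circ> g) ^^ Suc n = (f \<circ> (g \<circ> h) \<circ> Inv f) \<circ> f ^^ Suc n"
    using assms(3) h(2) by (simp add: fun_eq_iff)
  moreover have "f \<circ> (g \<circ> h) \<circ> Inv f \<in> N"
    using assms h perm_groupD(2)[OF assms(1)] by blast
  ultimately show ?case by blast
qed

text \<open>This is O_p(L). A plain union suffices: two normal p-subgroups both lie in their
  product, which is again a normal p-subgroup.\<close>

definition p_core :: "nat \<Rightarrow> ('a \<Rightarrow> 'a) set \<Rightarrow> ('a \<Rightarrow> 'a) set" where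
  "p_core p L = \<Union>{N. normal_sub N L \<and> (\<forall>f\<in>N. p_elem p f)}"

lemma p_core_greatest: "normal_sub N L \<Longrightarrow> (\<And>f. f \<in> N \<Longrightarrow> p_elem p f) \<Longrightarrow> N \<subseteq> p_core p L"
  by (auto simp: p_core_def)

lemma p_core_p_elem: "f \<in> p_core p L \<Longrightarrow> p_elem p f"
  by (auto simp: p_core_def)

lemma normal_sub_prod:
  assumes L: "perm_group L" and A: "normal_sub A L" and B: "normal_sub B L"
  shows "normal_sub {a \<circ> b | a b. a \<in> A \<and> b \<in> B} L"
proof -
  let ?P = "{a \<circ> b | a b. a \<in> A \<and> b \<in> B}"
  have A': "perm_group A" "A \<subseteq> L" "\<And>g h. g \<in> L \<Longrightarrow> h \<in> A \<Longrightarrow> g \<circ> h \<circ> Inv g \<in> A"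
    and B': "perm_group B" "B \<subseteq> L" "\<And>g h. g \<in> L \<Longrightarrow> h \<in> B \<Longrightarrow> g \<circ> h \<circ> Inv g \<in> B"
    using A B by (auto simp: normal_sub_def)
  have b: "bij f" if "f \<in> L" for f using that perm_groupD(4)[OF L] by auto
  have mul: "f \<circ> g \<in> ?P" if fg: "f \<in> ?P" "g \<in> ?P" for f g
  proof -
    obtain a c a' c' where *: "a \<in> A" "c \<in> B" "a' \<in> A" "c' \<in> B" "f = a \<circ> c" "g = a' \<circ> c'"
      using fg by auto
    have "f \<circ> g = (a \<circ> (c \<circ> a' \<circ> Inv c)) \<circ> (c \<circ> c')"
      using * b B'(2) by (auto simp: fun_eq_iff)
    moreover have "a \<circ> (c \<circ> a' \<circ> Inv c) \<in> A"
      using perm_groupD(2)[OF A'(1) *(1) A'(3)[OF subsetD[OF B'(2) *(2)] *(3)]] .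
    moreover have "c \<circ> c' \<in> B" using perm_groupD(2)[OF B'(1) *(2,4)] .
    ultimately show ?thesis by blast
  qed
  have inv: "Inv f \<in> ?P" if f: "f \<in> ?P" for f
  proof -
    obtain a c where *: "a \<in> A" "c \<in> B" "f = a \<circ> c" using f by auto
    have bj: "bij a" "bij c" using * A' B' b by auto
    have "Inv f = Inv c \<circ> Inv a" using bj * by (simp add: o_inv_distrib)
    also have "\<dots> = (Inv c \<circ> Inv a \<circ> Inv (Inv c)) \<circ> Inv c"
      using bj by (simp add: fun_eq_iff)
    finally have "Inv f = (Inv c \<circ> Inv a \<circ> Inv (Inv c)) \<circ> Inv c" .
    moreover have ic: "Inv c \<in> B" using perm_groupD(3)[OF B'(1) *(2)] .
    moreover have "Inv c \<circ> Inv a \<circ> Inv (Inv c) \<in> A"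
      using A'(3)[OF subsetD[OF B'(2) ic] perm_groupD(3)[OF A'(1) *(1)]] .
    ultimately show ?thesis by blast
  qed
  have sub: "?P \<subseteq> L" using A'(2) B'(2) perm_groupD(2)[OF L] by blast
  have "id \<in> ?P" using perm_groupD(1)[OF A'(1)] perm_groupD(1)[OF B'(1)]
    by (intro CollectI exI[of _ id] conjI) auto
  then have "perm_group ?P" using perm_group_subset[OF L _ sub] mul inv by blast
  moreover have "g \<circ> h \<circ> Inv g \<in> ?P" if gh: "g \<in> L" "h \<in> ?P" for g h
  proof -
    obtain a c where *: "a \<in> A" "c \<in> B" "h = a \<circ> c" using gh by auto
    have "g \<circ> h \<circ> Inv g = (g \<circ> a \<circ> Inv g) \<circ> (g \<circ> c \<circ> Inv g)"
      using b[OF gh(1)] * by (simp add: fun_eq_iff)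
    then show ?thesis using gh(1) * A' B' by blast
  qed
  ultimately show ?thesis using sub by (auto simp: normal_sub_def)
qed

text \<open>A p-power annihilates \<open>a\<close>, so the same power of the product lies in
  \<open>B\<close>, where a further p-power annihilates it.\<close>

lemma p_elem_prod:
  assumes "normal_sub B L" "a \<in> L" "perm_group L" "b \<in> B" "p_elem p a" "\<And>f. f \<in> B \<Longrightarrow> p_elem p f"
  shows "p_elem p (a \<circ> b)"
proof -
  obtain k where k: "a ^^ (p ^ k) = id" using assms(5) by (auto simp: p_elem_def)
  obtain h where h: "h \<in> B" "(a \<circ> b) ^^ (p ^ k) = h \<circ> a ^^ (p ^ k)"
    using funpow_comp_normalized[of B b a "p ^ k"] assms
    by (auto simp: normal_sub_def perm_groupD)
  obtain l where "h ^^ (p ^ l) = id" using assms(6)[OF h(1)] by (auto simp: p_elem_def)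
  then have "(a \<circ> b) ^^ (p ^ (k + l)) = id"
    using h(2) k by (simp add: power_add flip: funpow_mult')
  then show ?thesis by (auto simp: p_elem_def)
qed

lemma normal_sub_p_core:
  assumes L: "perm_group L"
  shows "normal_sub (p_core p L) L"
proof -
  have triv: "normal_sub {id} L" using L by (auto simp: normal_sub_def perm_group_def fun_eq_iff)
  have mul: "f \<circ> g \<in> p_core p L" if fg: "f \<in> p_core p L" "g \<in> p_core p L" for f g
  proof -
    obtain A B where A: "normal_sub A L" "\<forall>f\<in>A. p_elem p f" "f \<in> A"
      and B: "normal_sub B L" "\<forall>f\<in>B. p_elem p f" "g \<in> B"
      using fg unfolding p_core_def by blast
    have "A \<subseteq> L" using A by (auto simp: normal_sub_def)
    then have "{a \<circ> b | a b. a \<in> A \<and> b \<in> B} \<subseteq> p_core p L"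
      using A B L by (intro p_core_greatest normal_sub_prod) (auto intro!: p_elem_prod[OF B(1) _ L])
    then show ?thesis using A B by blast
  qed
  have "perm_group (p_core p L)"
    by (rule perm_group_subset[OF L])
      (use triv mul in \<open>auto simp: p_core_def normal_sub_def perm_groupD p_elem_def\<close>)
  then show ?thesis by (auto simp: normal_sub_def p_core_def)
qed

lemma normal_sub_conj_image:
  assumes g: "bij g" and L: "perm_group L" and N: "normal_sub N L"
  shows "normal_sub ((\<lambda>h. g \<circ> h \<circ> Inv g) ` N) ((\<lambda>h. g \<circ> h \<circ> Inv g) ` L)"
proof -
  have pg: "perm_group ((\<lambda>h. g \<circ> h \<circ> Inv g) ` K)" if "perm_group K" for K
    unfolding perm_group_def
  proof (intro conjI ballI)
    show "id \<in> (\<lambda>h. g \<circ> h \<circ> Inv g) ` K" using that g by (intro image_eqI[of _ _ id]) (auto simp: perm_group_def)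
  qed (use that g in \<open>auto simp: conj_comp conj_Inv perm_groupD intro!: bij_comp\<close>)
  have "(g \<circ> a \<circ> Inv g) \<circ> (g \<circ> b \<circ> Inv g) \<circ> Inv (g \<circ> a \<circ> Inv g) = g \<circ> (a \<circ> b \<circ> Inv a) \<circ> Inv g"
    if "a \<in> L" for a b
    using that g L by (simp add: conj_comp conj_Inv perm_groupD)
  then show ?thesis using pg N unfolding normal_sub_def
    by (auto simp del: o_apply)
qed

lemma p_core_conj:
  assumes g: "bij g" and L: "perm_group L" and f: "f \<in> p_core p L"
  shows "g \<circ> f \<circ> Inv g \<in> p_core p ((\<lambda>h. g \<circ> h \<circ> Inv g) ` L)"
proof -
  obtain N where N: "normal_sub N L" "\<forall>f\<in>N. p_elem p f" "f \<in> N" using f by (auto simp: p_core_def)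
  have "(\<lambda>h. g \<circ> h \<circ> Inv g) ` N \<subseteq> p_core p ((\<lambda>h. g \<circ> h \<circ> Inv g) ` L)"
    using N g L by (intro p_core_greatest normal_sub_conj_image) (auto simp: p_elem_conj)
  then show ?thesis using N by auto
qed

section \<open>Three-cycles\<close>

definition cyc3 :: "'a \<Rightarrow> 'a \<Rightarrow> 'a \<Rightarrow> 'a \<Rightarrow> 'a" where
  "cyc3 a b c x = (if x = a then b else if x = b then c else if x = c then a else x)"

lemma cyc3_simps:
  assumes "distinct [a, b, c]"
  shows "cyc3 a b c a = b" "cyc3 a b c b = c" "cyc3 a b c c = a"
  using assms by (auto simp: cyc3_def)

lemma cyc3_inverse: "distinct [a, b, c] \<Longrightarrow> cyc3 c b a (cyc3 a b c x) = x"
  by (auto simp: cyc3_def)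

lemma bij_cyc3:
  assumes "distinct [a, b, c]"
  shows "bij (cyc3 a b c)"
proof (rule o_bij)
  have "distinct [c, b, a]" using assms by auto
  then show "cyc3 c b a \<circ> cyc3 a b c = id" "cyc3 a b c \<circ> cyc3 c b a = id"
    using assms cyc3_inverse[of a b c] cyc3_inverse[of c b a] by (auto simp: fun_eq_iff)
qed

lemma Inv_cyc3:
  assumes "distinct [a, b, c]"
  shows "Inv (cyc3 a b c) = cyc3 c b a"
proof -
  have "distinct [c, b, a]" using assms by auto
  then show ?thesis
    using cyc3_inverse[of c b a] by (auto simp: fun_eq_iff Inv_eq_iff bij_cyc3 assms)
qed

lemma cyc3_rotate: "distinct [a, b, c] \<Longrightarrow> cyc3 a b c = cyc3 b c a"
  by (auto simp: cyc3_def fun_eq_iff)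

lemma cyc3_conj:
  assumes "bij s"
  shows "s \<circ> cyc3 a b c \<circ> Inv s = cyc3 (s a) (s b) (s c)"
  using assms by (auto simp: cyc3_def fun_eq_iff Inv_eq_iff)

lemma cyc3_permutes:
  "distinct [a, b, c] \<Longrightarrow> {a, b, c} \<subseteq> E \<Longrightarrow> cyc3 a b c permutes E"
  using bij_cyc3[of a b c] by (auto simp: permutes_def bij_iff cyc3_def)

text \<open>This commutator moves at most five points, which starts the search for three-cycles in
  a normal subgroup.\<close>

lemma normal_sub_cyc3_quotient:
  assumes "perm_group I" "normal_sub N I" "s \<in> N" "cyc3 a b c \<in> I" "distinct [a, b, c]"
  shows "cyc3 (s a) (s b) (s c) \<circ> cyc3 c b a \<in> N"
proof -
  have N: "perm_group N" "N \<subseteq> I" "\<And>g h. g \<in> I \<Longrightarrow> h \<in> N \<Longrightarrow> g \<circ> h \<circ> Inv g \<in> N"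
    using assms(2) by (auto simp: normal_sub_def)
  let ?t = "cyc3 a b c"
  have bs: "bij s" using N assms(3) by (auto simp: perm_group_def)
  have "s \<circ> (?t \<circ> Inv s \<circ> Inv ?t) \<in> N"
    using N assms(3,4) perm_groupD(2,3)[OF N(1)] by blast
  also have "s \<circ> (?t \<circ> Inv s \<circ> Inv ?t) = (s \<circ> ?t \<circ> Inv s) \<circ> Inv ?t"
    by (simp add: fun_eq_iff)
  finally show ?thesis by (simp only: cyc3_conj[OF bs] Inv_cyc3[OF assms(5)])
qed

text \<open>The rule \<open>quot\<close> produces elements of \<open>N\<close> that are products of
  two three-cycles; the points are chosen along the orbits of a given element so that the product
  simplifies. The cases are an orbit of length at least four, an orbit of length three, and
  involutions with and without a fixed point. Five points rule out the Klein four-group, whose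
  fixed-point-free involutions have only two transpositions.\<close>

lemma normal_sub_contains_cyc3:
  assumes I: "perm_group I" "\<And>p. p \<in> I \<Longrightarrow> p permutes E"
    and cyc: "\<And>a b c. {a, b, c} \<subseteq> E \<Longrightarrow> distinct [a, b, c] \<Longrightarrow> cyc3 a b c \<in> I"
    and N: "normal_sub N I" "\<sigma> \<in> N" "\<sigma> \<noteq> id" and E: "finite E" "5 \<le> card E"
  shows "\<exists>a b c. {a, b, c} \<subseteq> E \<and> distinct [a, b, c] \<and> cyc3 a b c \<in> N"
proof -
  have perm: "s permutes E" if "s \<in> N" for s
    using that N(1) I(2) by (auto simp: normal_sub_def)
  have inE: "s x \<in> E \<longleftrightarrow> x \<in> E" if "s \<in> N" for s x
    using perm[OF that] by (simp add: permutes_in_image)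
  have inj: "s x = s y \<longleftrightarrow> x = y" if "s \<in> N" for s x y
    using permutes_inj[OF perm[OF that]] by (rule inj_eq)
  have moved: "x \<in> E" if "s \<in> N" "s x \<noteq> x" for s x
    using permutes_not_in[OF perm[OF that(1)]] that(2) by blast
  have quot: "cyc3 (s a) (s b) (s c) \<circ> cyc3 c b a \<in> N"
    if "s \<in> N" "{a, b, c} \<subseteq> E" "distinct [a, b, c]" for s a b c
    using normal_sub_cyc3_quotient[OF I(1) N(1) that(1) cyc[OF that(2,3)] that(3)] .
  \<comment> \<open>For a path of four distinct points the two factors share \<open>b\<close> and
    \<open>c\<close>, and their product is a three-cycle.\<close>
  have long: ?thesis if s: "s \<in> N" "s a = b" "s b = c" "s c = d" "distinct [a, b, c, d]" for s a b c d
  proof -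
    have sub: "a \<in> E" "b \<in> E" "c \<in> E" "d \<in> E"
      using moved[OF s(1), of a] inE[OF s(1), of a] inE[OF s(1), of b] inE[OF s(1), of c] s(5)
      unfolding s(2-4) by auto
    have "cyc3 b c d \<circ> cyc3 c b a \<in> N"
      using quot[OF s(1), of a b c] s(5) sub unfolding s(2-4) by simp
    also have "cyc3 b c d \<circ> cyc3 c b a = cyc3 a d b"
      using s(5) by (auto simp: cyc3_def fun_eq_iff)
    finally show ?thesis using s(5) sub by (intro exI[of _ a] exI[of _ d] exI[of _ b]) auto
  qed
  have three: ?thesis if s: "s \<in> N" "s a = b" "s b = c" "s c = a" "distinct [a, b, c]" for s a b c
  proof -
    have sub: "a \<in> E" "b \<in> E" "c \<in> E"
      using moved[OF s(1), of a] inE[OF s(1), of a] inE[OF s(1), of b] s(5) unfolding s(2-4) by auto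
    show ?thesis
    proof (cases "s = cyc3 a b c")
      case True
      then show ?thesis using s(1,5) sub by (intro exI[of _ a] exI[of _ b] exI[of _ c]) auto
    next
      case False
      then obtain x where x: "s x \<noteq> cyc3 a b c x" by (auto simp: fun_eq_iff)
      obtain y where y: "s x = y" by blast
      have x1: "x \<noteq> a" "x \<noteq> b" "x \<noteq> c" using x s(2-4) cyc3_simps[OF s(5)] by metis+
      then have "cyc3 a b c x = x" by (simp add: cyc3_def)
      then have x': "x \<noteq> a" "x \<noteq> b" "x \<noteq> c" "y \<noteq> x" using x1 x y by metis+
      have y': "y \<noteq> a" "y \<noteq> b" "y \<noteq> c"
        using x' y s(2-4) inj[OF s(1), of x] by metis+
      have xE: "x \<in> E" using moved[OF s(1), of x] x' y by metis
      \<comment> \<open>Since \<open>s\<close> also moves \<open>x\<close> to \<open>y\<close>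
        outside its three-cycle, \<open>r\<close> has the path \<open>a\<close>, \<open>x\<close>,
        \<open>c\<close>, \<open>y\<close>, to which \<open>long\<close> applies.\<close>
      define r where "r = cyc3 b c y \<circ> cyc3 x b a"
      have r: "r \<in> N" using quot[OF s(1), of a b x] s(5) sub xE x' unfolding s(2,3) y r_def by simp
      have "r a = x" "r x = c" "r c = y"
        using x' y' s(5) by (auto simp: cyc3_def r_def)
      then show ?thesis using long[OF r, of a x c y] x' y' s(5) by auto
    qed
  qed
  show ?thesis
  proof (cases "\<exists>a. \<sigma> (\<sigma> a) \<noteq> a")
    case True
    then obtain a where a: "\<sigma> (\<sigma> a) \<noteq> a" by blast
    obtain b c d where bcd: "\<sigma> a = b" "\<sigma> b = c" "\<sigma> c = d" by blast
    have ne: "a \<noteq> b" "a \<noteq> c" "b \<noteq> c" "d \<noteq> c" "d \<noteq> b"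
      using a bcd inj[OF N(2), of a b] inj[OF N(2), of b c] inj[OF N(2), of a c] by metis+
    show ?thesis
    proof (cases "d = a")
      case True
      then show ?thesis using three[OF N(2), of a b c] bcd ne by auto
    next
      case False
      then show ?thesis using long[OF N(2), of a b c d] bcd ne by auto
    qed
  next
    case False
    then have sq: "\<sigma> (\<sigma> x) = x" for x by blast
    obtain a where a: "\<sigma> a \<noteq> a" using N(3) by (auto simp: fun_eq_iff)
    obtain b where b: "\<sigma> a = b" "\<sigma> b = a" using sq by blast
    have aE: "a \<in> E" "b \<in> E" using moved[OF N(2) a] inE[OF N(2), of a] b by auto
    have ab: "a \<noteq> b" using a b by auto
    show ?thesis
    proof (cases "\<exists>e\<in>E. \<sigma> e = e")
      case True
      then obtain e where e: "e \<in> E" "\<sigma> e = e" by blast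
      have ne: "e \<noteq> a" "e \<noteq> b" using e ab b by metis+
      \<comment> \<open>Both factors are the same three-cycle, so the product is its square, that
        is, its inverse.\<close>
      have "cyc3 b a e \<circ> cyc3 e b a \<in> N"
        using quot[OF N(2), of a b e] ab aE e(1) ne unfolding b e(2) by simp
      also have "cyc3 b a e \<circ> cyc3 e b a = cyc3 a b e"
        using ab ne by (auto simp: cyc3_def fun_eq_iff)
      finally show ?thesis using aE e ne ab by (intro exI[of _ a] exI[of _ b] exI[of _ e]) auto
    next
      case False
      have small: "\<exists>x\<in>E. x \<notin> {a, b, c, d}" for c d
      proof -
        have "card {a, b, c, d} \<le> 4" by (simp add: card_insert_if)
        then have "\<not> E \<subseteq> {a, b, c, d}" using E(2) card_mono[of "{a, b, c, d}" E] by auto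
        then show ?thesis by blast
      qed
      obtain c where c: "c \<in> E" "c \<noteq> a" "c \<noteq> b" using small[of a b] by auto
      obtain d where d: "\<sigma> c = d" "\<sigma> d = c" using sq by blast
      obtain e where e: "e \<in> E" "e \<noteq> a" "e \<noteq> b" "e \<noteq> c" "e \<noteq> d" using small[of c d] by auto
      obtain f where f: "\<sigma> e = f" "\<sigma> f = e" using sq by blast
      \<comment> \<open>With three transpositions (a b), (c d), (e f) available, the two factors are
        disjoint three-cycles, and \<open>three\<close> applies.\<close>
      define r where "r = cyc3 b d f \<circ> cyc3 e c a"
      have r: "r \<in> N" using quot[OF N(2), of a c e] aE c e unfolding b(1) d(1) f(1) r_def by simp
      have ne: "d \<noteq> c" "f \<noteq> e" using False c d e f by auto
      have ne2: "d \<noteq> a" "d \<noteq> b" "f \<noteq> a" "f \<noteq> b" "f \<noteq> c" "f \<noteq> d" using b c d e f by metis+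
      have v: "r a = e" "r e = c" "r c = a"
        using ne ne2 ab c e by (auto simp: cyc3_def r_def)
      show ?thesis using three[OF r, of a e c] v c e by auto
    qed
  qed
qed

text \<open>Conjugation by \<open>cyc3 z w u\<close> replaces \<open>z\<close> by \<open>w\<close>
  in a three-cycle and leaves \<open>x\<close> and \<open>y\<close> alone. The fifth point
  \<open>u\<close> is there to make the conjugating element a three-cycle, hence a member of
  \<open>I\<close>. Together with rotation, this reaches every triple one entry at a time.\<close>

lemma normal_sub_all_cyc3:
  assumes I: "perm_group I" "\<And>p. p \<in> I \<Longrightarrow> p permutes E"
    and cyc: "\<And>a b c. {a, b, c} \<subseteq> E \<Longrightarrow> distinct [a, b, c] \<Longrightarrow> cyc3 a b c \<in> I"
    and N: "normal_sub N I" "\<sigma> \<in> N" "\<sigma> \<noteq> id" and E: "finite E" "5 \<le> card E"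
    and abc: "{a, b, c} \<subseteq> E" "distinct [a, b, c]"
  shows "cyc3 a b c \<in> N"
proof -
  define Q where "Q x y z \<longleftrightarrow> {x, y, z} \<subseteq> E \<and> distinct [x, y, z] \<and> cyc3 x y z \<in> N" for x y z
  have rot: "Q y z x" if "Q x y z" for x y z
    using that cyc3_rotate[of x y z] by (auto simp: Q_def)
  have new: "\<exists>u\<in>E. u \<notin> {x, y, z, w}" for x y z w
  proof -
    have "card {x, y, z, w} \<le> 4" by (simp add: card_insert_if)
    then have "\<not> E \<subseteq> {x, y, z, w}" using E(2) card_mono[of "{x, y, z, w}" E] by auto
    then show ?thesis by blast
  qed
  have step: "Q x y w" if Q: "Q x y z" and w: "w \<in> E" "w \<notin> {x, y}" for x y z w
  proof (cases "w = z")
    case False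
    obtain u where u: "u \<in> E" "u \<notin> {x, y, z, w}" using new by blast
    let ?t = "cyc3 z w u"
    have d: "distinct [z, w, u]" using Q u w False by (auto simp: Q_def)
    then have "?t \<circ> cyc3 x y z \<circ> Inv ?t \<in> N"
      using N(1) cyc[of z w u] Q u w by (auto simp: Q_def normal_sub_def simp del: o_apply)
    then have "cyc3 (?t x) (?t y) (?t z) \<in> N" by (simp only: cyc3_conj[OF bij_cyc3[OF d]])
    moreover have "?t x = x" "?t y = y" "?t z = w" using Q u w d by (auto simp: cyc3_def Q_def)
    ultimately show ?thesis using Q w by (auto simp: Q_def)
  qed (use Q in simp)
  obtain x y z where xyz: "Q x y z"
    using normal_sub_contains_cyc3[OF I cyc N E] by (auto simp: Q_def)
  have "\<exists>y z. Q a y z"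
    using xyz rot step[of y z x a] abc(1) by (metis insertE insert_subset singletonD)
  then obtain y z where 1: "Q a y z" by blast
  have "\<exists>z. Q a b z"
  proof (cases "b = z")
    case True
    \<comment> \<open>Here \<open>b\<close> already stands in third place and cannot replace
      \<open>y\<close> directly; a fresh point \<open>w\<close> displaces it first.\<close>
    obtain w where w: "w \<in> E" "w \<notin> {a, y, b}" using new[of a y b b] by auto
    have "Q a y w" using step[OF 1 w(1)] w by auto
    then have "Q w a y" using rot by blast
    then have "Q w a b" using step[of w a y b] abc w by auto
    then show ?thesis using rot by blast
  next
    case False
    have "Q z a y" using rot 1 by blast
    then have "Q z a b" using step[of z a y b] abc False by auto
    then show ?thesis using rot by blast
  qed
  then obtain z where "Q a b z" by blast
  then have "Q a b c" using step[of a b z c] abc by auto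
  then show ?thesis by (simp add: Q_def)
qed

text \<open>A product of two transpositions is a product of three-cycles, so \<open>I\<close> and
  its coset by one fixed transposition cover the symmetric group on \<open>E\<close>.\<close>

lemma fact_card_le_two_card_cyc3:
  assumes I: "perm_group I" "\<And>p. p \<in> I \<Longrightarrow> p permutes E"
    and cyc: "\<And>a b c. {a, b, c} \<subseteq> E \<Longrightarrow> distinct [a, b, c] \<Longrightarrow> cyc3 a b c \<in> I"
    and E: "finite E" "2 \<le> card E"
  shows "fact (card E) \<le> 2 * card I"
proof -
  obtain a b where ab: "a \<in> E" "b \<in> E" "a \<noteq> b"
    using card_le_Suc0_iff_eq[OF E(1)] E(2) by fastforce
  let ?t = "Transposition.transpose a b"
  have adj: "Transposition.transpose x y \<circ> Transposition.transpose y z \<in> I" if "{x, y, z} \<subseteq> E" "x \<noteq> y" "y \<noteq> z" for x y z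
  proof (cases "x = z")
    case True
    then show ?thesis using perm_groupD(1)[OF I(1)] by (simp add: transpose_commute)
  next
    case False
    have "Transposition.transpose x y \<circ> Transposition.transpose y z = cyc3 x y z"
      using that False by (auto simp: transpose_def cyc3_def fun_eq_iff)
    then show ?thesis using cyc[of x y z] that False by auto
  qed
  have two: "Transposition.transpose x y \<circ> Transposition.transpose u v \<in> I" if "{x, y, u, v} \<subseteq> E" "x \<noteq> y" "u \<noteq> v" for x y u v
  proof (cases "y = u")
    case True
    then show ?thesis using adj[of x y v] that by auto
  next
    case False
    \<comment> \<open>Inserting the transposition of \<open>y\<close> and \<open>u\<close> twice
      links two transpositions that need not share a point.\<close>
    have "(Transposition.transpose x y \<circ> Transposition.transpose y u) \<circ> (Transposition.transpose y u \<circ> Transposition.transpose u v) \<in> I"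
      using adj[of x y u] adj[of y u v] that False perm_groupD(2)[OF I(1)] by auto
    moreover have "(Transposition.transpose x y \<circ> Transposition.transpose y u) \<circ> (Transposition.transpose y u \<circ> Transposition.transpose u v) = Transposition.transpose x y \<circ> Transposition.transpose u v"
      by (simp add: fun_eq_iff)
    ultimately show ?thesis by simp
  qed
  have tt: "p \<circ> ?t \<circ> ?t = p" for p :: "'a \<Rightarrow> 'a" by (simp add: fun_eq_iff)
  have *: "p \<in> I \<or> p \<circ> ?t \<in> I" if "p permutes E" for p
    using E(1) that
  proof (induction rule: permutes_rev_induct)
    case id
    then show ?case using perm_groupD(1)[OF I(1)] by blast
  next
    case (swap x y p)
    show ?case
    proof (cases "p \<in> I")
      case True
      have "p \<circ> (Transposition.transpose x y \<circ> ?t) \<in> I"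
        using True two[of x y a b] swap.hyps ab perm_groupD(2)[OF I(1)] by blast
      then show ?thesis unfolding o_assoc by blast
    next
      case False
      then have "p \<circ> ?t \<in> I" using swap.IH by blast
      then have "(p \<circ> ?t) \<circ> (?t \<circ> Transposition.transpose x y) \<in> I"
        using two[of a b x y] swap.hyps ab perm_groupD(2)[OF I(1)] by blast
      then show ?thesis unfolding o_assoc tt by blast
    qed
  qed
  have fI: "finite I"
    by (rule finite_subset[OF _ finite_permutations[OF E(1)]]) (use I(2) in blast)
  have "{p. p permutes E} \<subseteq> I \<union> (\<lambda>p. p \<circ> ?t) ` I"
  proof
    fix p assume "p \<in> {p. p permutes E}"
    then consider "p \<in> I" | "p \<circ> ?t \<in> I" using *[of p] by blast
    then show "p \<in> I \<union> (\<lambda>p. p \<circ> ?t) ` I"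
    proof cases
      case 2
      then show ?thesis by (intro UnI2 image_eqI[of _ _ "p \<circ> ?t"]) (simp_all only: tt)
    qed simp
  qed
  then have "card {p. p permutes E} \<le> card (I \<union> (\<lambda>p. p \<circ> ?t) ` I)"
    using fI by (intro card_mono) auto
  also have "\<dots> \<le> card I + card I"
    using card_Un_le[of I "(\<lambda>p. p \<circ> ?t) ` I"] card_image_le[OF fI, of "\<lambda>p. p \<circ> ?t"] by linarith
  finally show ?thesis using card_permutations[OF refl E(1)] by simp
qed

section \<open>Permutations of three points\<close>

lemma perm3_cases:
  assumes "distinct [p, q, s]" "f ` {p, q, s} \<subseteq> {p, q, s}" "bij f"
  shows "f p = p \<and> f q = q \<and> f s = s \<or> f p = p \<and> f q = s \<and> f s = q \<or> f p = q \<and> f q = p \<and> f s = s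
    \<or> f p = q \<and> f q = s \<and> f s = p \<or> f p = s \<and> f q = p \<and> f s = q \<or> f p = s \<and> f q = q \<and> f s = p"
proof -
  have "f p \<noteq> f q" "f p \<noteq> f s" "f q \<noteq> f s" using assms by (auto dest: bij_is_inj injD)
  moreover have "f p = p \<or> f p = q \<or> f p = s" "f q = p \<or> f q = q \<or> f q = s" "f s = p \<or> f s = q \<or> f s = s"
    using assms(2) by auto
  ultimately show ?thesis by metis
qed

lemma perm3_order:
  assumes "card F = 3" "f ` F \<subseteq> F" "bij f"
  shows "(\<forall>x\<in>F. f (f x) = x) \<or> (\<forall>x\<in>F. f (f (f x)) = x)"
proof -
  obtain p q s where F: "F = {p, q, s}" "distinct [p, q, s]"
    using assms(1) by (auto simp: card_3_iff)
  have f: "f ` {p, q, s} \<subseteq> {p, q, s}" using assms(2) F(1) by simp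
  show ?thesis using perm3_cases[OF F(2) f assms(3)] unfolding F(1) by auto
qed

text \<open>The derived subgroup of the symmetric group of degree three has order three.\<close>

lemma perm3_commut_cube:
  assumes "card F = 3" "f ` F \<subseteq> F" "bij f" "g ` F \<subseteq> F" "bij g" "x \<in> F"
  shows "commut f g (commut f g (commut f g x)) = x"
proof -
  obtain p q s where F: "F = {p, q, s}" "distinct [p, q, s]"
    using assms(1) by (auto simp: card_3_iff)
  have fi: "f u = v \<Longrightarrow> Inv f v = u" and gi: "g u = v \<Longrightarrow> Inv g v = u" for u v
    using assms by auto
  have f: "f ` {p, q, s} \<subseteq> {p, q, s}" and g: "g ` {p, q, s} \<subseteq> {p, q, s}"
    using assms(2,4) F(1) by simp_all
  have "x = p \<or> x = q \<or> x = s" using assms(6) F(1) by auto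
  then show ?thesis using perm3_cases[OF F(2) f assms(3)] perm3_cases[OF F(2) g assms(5)]
    by (elim disjE conjE) (simp_all add: commut_def fi gi)
qed

text \<open>Permutations of three points with trivial cube form the alternating group of degree
  three, which is abelian of exponent three.\<close>

lemma perm3_cube_closed:
  assumes "card F = 3" "f ` F \<subseteq> F" "bij f" "g ` F \<subseteq> F" "bij g"
    "\<And>x. x \<in> F \<Longrightarrow> f (f (f x)) = x" "\<And>x. x \<in> F \<Longrightarrow> g (g (g x)) = x" "x \<in> F"
  shows "f (g x) = g (f x)" "f (g (f (g (f (g x))))) = x"
proof -
  obtain p q s where F: "F = {p, q, s}" "distinct [p, q, s]"
    using assms(1) by (auto simp: card_3_iff)
  have cases: "h p = p \<and> h q = q \<and> h s = s \<or> h p = q \<and> h q = s \<and> h s = p \<or> h p = s \<and> h q = p \<and> h s = q"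
    if h: "h ` F \<subseteq> F" "bij h" "\<And>x. x \<in> F \<Longrightarrow> h (h (h x)) = x" for h
  proof -
    have "h (h (h p)) = p" "h (h (h q)) = q" "h (h (h s)) = s" using h(3) F(1) by auto
    then show ?thesis using perm3_cases[OF F(2) h(1)[unfolded F(1)] h(2)] F(2)
      by (elim disjE conjE) simp_all
  qed
  have "x = p \<or> x = q \<or> x = s" using assms(8) F(1) by auto
  then have "f (g x) = g (f x) \<and> f (g (f (g (f (g x))))) = x"
    using cases[OF assms(2,3,6)] cases[OF assms(4,5,7)] by auto
  then show "f (g x) = g (f x)" "f (g (f (g (f (g x))))) = x" by auto
qed

text \<open>The condition at \<open>z\<close> excludes the identity and the transpositions, so
  \<open>f\<close> rotates \<open>F\<close>.\<close>

lemma perm3_transitive: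
  assumes "card F = 3" "f ` F \<subseteq> F" "bij f" "z \<in> F" "f (f z) \<noteq> z"
  shows "y \<in> F \<Longrightarrow> y \<in> {z, f z, f (f z)}" "f (f (f z)) = z"
proof -
  obtain p q s where F: "F = {p, q, s}" "distinct [p, q, s]"
    using assms(1) by (auto simp: card_3_iff)
  have f: "f ` {p, q, s} \<subseteq> {p, q, s}" using assms(2) F(1) by simp
  have "(\<forall>y\<in>F. y \<in> {z, f z, f (f z)}) \<and> f (f (f z)) = z"
    using perm3_cases[OF F(2) f assms(3)] assms(4,5) F(2) unfolding F(1) by auto
  then show "y \<in> F \<Longrightarrow> y \<in> {z, f z, f (f z)}" "f (f (f z)) = z" by auto
qed

section \<open>Arc-transitive groups\<close>

locale arc_transitive_group =
  fixes V :: "'a set" and A :: "('a \<times> 'a) set" and G :: "('a \<Rightarrow> 'a) set"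
  assumes finite_V: "finite V"
    and A_subset: "A \<subseteq> V \<times> V"
    and A_sym: "(x, y) \<in> A \<Longrightarrow> (y, x) \<in> A"
    and A_irrefl: "(x, x) \<notin> A"
    and A_connected: "x \<in> V \<Longrightarrow> y \<in> V \<Longrightarrow> (x, y) \<in> A\<^sup>*"
    and G_group: "perm_group G"
    and G_permutes: "g \<in> G \<Longrightarrow> g permutes V"
    and G_arcs: "g \<in> G \<Longrightarrow> (x, y) \<in> A \<Longrightarrow> (g x, g y) \<in> A"
    and G_transitive: "(x, y) \<in> A \<Longrightarrow> (u, v) \<in> A \<Longrightarrow> \<exists>g\<in>G. g x = u \<and> g y = v"
begin

definition nbr :: "'a \<Rightarrow> 'a set" where
  "nbr x = {y. (x, y) \<in> A}"

definition arc_stab :: "'a \<Rightarrow> 'a \<Rightarrow> ('a \<Rightarrow> 'a) set" where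
  "arc_stab x y = {g \<in> G. g x = x \<and> g y = y}"

definition ball_stab :: "'a \<Rightarrow> ('a \<Rightarrow> 'a) set" where
  "ball_stab x = {g \<in> G. \<forall>z\<in>insert x (nbr x). g z = z}"

lemma finite_nbr: "finite (nbr x)"
  by (rule finite_subset[OF _ finite_V]) (use A_subset in \<open>auto simp: nbr_def\<close>)

lemma G_bij: "g \<in> G \<Longrightarrow> bij g"
  using G_group by (rule perm_groupD(4))

lemma nbr_image_iff:
  assumes "g \<in> G"
  shows "g z \<in> nbr (g x) \<longleftrightarrow> z \<in> nbr x"
proof
  assume "g z \<in> nbr (g x)"
  then have "(Inv g (g x), Inv g (g z)) \<in> A"
    using G_arcs[OF perm_groupD(3)[OF G_group assms]] by (auto simp: nbr_def)
  then show "z \<in> nbr x" using G_bij[OF assms] by (simp add: nbr_def)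
qed (use assms G_arcs in \<open>auto simp: nbr_def\<close>)

lemma nbr_image: "g \<in> G \<Longrightarrow> g ` nbr x = nbr (g x)"
proof
  assume g: "g \<in> G"
  show "nbr (g x) \<subseteq> g ` nbr x"
  proof
    fix y assume "y \<in> nbr (g x)"
    moreover have "y = g (Inv g y)" using G_bij[OF g] by simp
    ultimately show "y \<in> g ` nbr x" using nbr_image_iff[OF g, of "Inv g y" x] by auto
  qed
qed (use nbr_image_iff in auto)

lemma not_isolated:
  assumes "A \<noteq> {}" "x \<in> V"
  shows "nbr x \<noteq> {}"
proof -
  obtain v w where vw: "(v, w) \<in> A" using assms(1) by auto
  then have "v \<in> V" using A_subset by auto
  then have "(x, v) \<in> A\<^sup>*" using A_connected[OF assms(2)] by blast
  then show ?thesis using vw by (cases rule: converse_rtranclE) (auto simp: nbr_def)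
qed

lemma card_nbr_eq:
  assumes "x \<in> V" "y \<in> V"
  shows "card (nbr x) = card (nbr y)"
proof (cases "A = {}")
  case False
  obtain u v where "(x, u) \<in> A" "(y, v) \<in> A"
    using not_isolated[OF False assms(1)] not_isolated[OF False assms(2)] by (auto simp: nbr_def)
  then obtain g where g: "g \<in> G" "g x = y" using G_transitive by blast
  have "card (g ` nbr x) = card (nbr x)"
    using G_bij[OF g(1)] by (intro card_image) (auto intro: inj_on_subset bij_is_inj)
  then show ?thesis using nbr_image[OF g(1), of x] g(2) by simp
next
  case True
  then have "nbr z = {}" for z unfolding nbr_def by blast
  then show ?thesis by simp
qed

lemma fixing_V_trivial: "g \<in> G \<Longrightarrow> (\<And>x. x \<in> V \<Longrightarrow> g x = x) \<Longrightarrow> g = id"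
  using permutes_not_in[OF G_permutes] by (auto simp: fun_eq_iff)

lemma nbr_closed_imp_V:
  assumes "v \<in> S" "v \<in> V" "\<And>x. x \<in> S \<Longrightarrow> nbr x \<subseteq> S"
  shows "V \<subseteq> S"
proof
  fix x assume "x \<in> V"
  with assms(2) have "(v, x) \<in> A\<^sup>*" by (rule A_connected)
  then show "x \<in> S"
    by (induction rule: rtrancl_induct) (use assms in \<open>auto simp: nbr_def\<close>)
qed

text \<open>The walk through the graph, phrased with a maximal vertex set \<open>S\<close> whose
  pointwise stabilizer in \<open>K\<close> still satisfies \<open>\<Phi>\<close>. By
  \<open>step\<close>, adding a neighbourhood keeps \<open>\<Phi>\<close>, so maximality closes
  \<open>S\<close> under neighbours; connectedness gives all of \<open>V\<close>, and only the
  identity fixes \<open>V\<close> pointwise.\<close>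

lemma stabilizer_tower:
  assumes K: "perm_group K" "K \<subseteq> G" and vw: "(v, w) \<in> A" "\<And>k. k \<in> K \<Longrightarrow> k v = v \<and> k w = w"
    and \<Phi>: "\<Phi> K"
    and step: "\<And>K x y. perm_group K \<Longrightarrow> K \<subseteq> arc_stab x y \<Longrightarrow> (x, y) \<in> A \<Longrightarrow> \<Phi> K \<Longrightarrow>
      \<Phi> {k \<in> K. \<forall>z\<in>nbr x. k z = z}"
  shows "\<Phi> {id}"
proof -
  \<comment> \<open>Every vertex of \<open>S\<close> has a neighbour in \<open>S\<close>, so the
    stabilizer of \<open>S\<close> lies in an arc stabilizer at that vertex, as \<open>step\<close>
    demands.\<close>
  define \<S> where "\<S> = {S. S \<subseteq> V \<and> v \<in> S \<and> (\<forall>x\<in>S. \<exists>y\<in>S. (x, y) \<in> A) \<and> \<Phi> {k \<in> K. \<forall>z\<in>S. k z = z}}"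
  have "{k \<in> K. \<forall>z\<in>{v, w}. k z = z} = K" using vw by auto
  then have "{v, w} \<in> \<S>" using vw A_subset A_sym \<Phi> by (auto simp: \<S>_def)
  moreover have "finite \<S>"
    by (rule finite_subset[of _ "Pow V"]) (auto simp: \<S>_def finite_V)
  ultimately obtain S where S: "S \<in> \<S>" "\<And>T. T \<in> \<S> \<Longrightarrow> S \<subseteq> T \<Longrightarrow> S = T"
    using finite_has_maximal[of \<S>] by blast
  let ?K = "{k \<in> K. \<forall>z\<in>S. k z = z}"
  have "nbr x \<subseteq> S" if x: "x \<in> S" for x
  proof -
    obtain y where y: "y \<in> S" "(x, y) \<in> A" using S(1) x by (auto simp: \<S>_def)
    have "\<Phi> {k \<in> ?K. \<forall>z\<in>nbr x. k z = z}"
      using S(1) K x y by (intro step[of ?K x y] perm_group_stab) (auto simp: \<S>_def arc_stab_def)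
    moreover have "{k \<in> ?K. \<forall>z\<in>nbr x. k z = z} = {k \<in> K. \<forall>z\<in>S \<union> nbr x. k z = z}" by auto
    moreover have "nbr x \<subseteq> V" using A_subset by (auto simp: nbr_def)
    moreover have "\<exists>z\<in>S \<union> nbr x. (y, z) \<in> A" if "y \<in> S \<union> nbr x" for y
    proof (cases "y \<in> S")
      case True
      then show ?thesis using S(1) by (auto simp: \<S>_def)
    next
      case False
      then show ?thesis using that x A_sym by (auto simp: nbr_def)
    qed
    ultimately have "S \<union> nbr x \<in> \<S>" using S(1) by (auto simp: \<S>_def)
    then show ?thesis using S(2) by blast
  qed
  then have "V \<subseteq> S" using nbr_closed_imp_V[of v S] S(1) by (auto simp: \<S>_def)
  then have "k = id" if "k \<in> ?K" for k
    using that K by (intro fixing_V_trivial) auto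
  then have "?K = {id}" using perm_groupD(1)[OF K(1)] by auto
  then show ?thesis using S(1) by (simp add: \<S>_def)
qed

text \<open>Reversing an arc and changing its end carry \<open>f\<close> along every walk, so
  \<open>f\<close> lies in the stabilizer of every arc. The families used later are p-cores of arc
  stabilizers and sets of 2-elements fixing two adjacent neighbourhoods.\<close>

lemma arc_family_trivial:
  assumes vw: "(v, w) \<in> A" "f \<in> R v w"
    and sym: "\<And>x y. (x, y) \<in> A \<Longrightarrow> R x y \<subseteq> R y x"
    and change: "\<And>x y z. (x, y) \<in> A \<Longrightarrow> (x, z) \<in> A \<Longrightarrow> R x y \<subseteq> R x z"
    and stab: "\<And>x y. (x, y) \<in> A \<Longrightarrow> R x y \<subseteq> arc_stab x y"
  shows "f = id"
proof (rule fixing_V_trivial)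
  show "f \<in> G" using stab[OF vw(1)] vw(2) by (auto simp: arc_stab_def)
  fix x assume x: "x \<in> V"
  have "v \<in> V" using vw A_subset by auto
  then have "(v, x) \<in> A\<^sup>*" using x by (rule A_connected)
  then have "\<forall>y\<in>nbr x. f \<in> R x y"
  proof (induction rule: rtrancl_induct)
    case base
    then show ?case using vw change by (auto simp: nbr_def)
  next
    case (step x z)
    then have "f \<in> R z x" using sym[of x z] by (auto simp: nbr_def)
    then show ?case using change[of z x] A_sym[OF step(2)] by (auto simp: nbr_def)
  qed
  moreover obtain y where "y \<in> nbr x" using not_isolated[OF _ x] vw by auto
  ultimately show "f x = x" using stab[of x y] by (auto simp: nbr_def arc_stab_def)
qed

lemma perm_group_arc_stab: "perm_group (arc_stab x y)"
  using perm_group_stab[OF G_group, of "{x, y}"] by (simp add: arc_stab_def)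

lemma perm_group_ball_stab: "perm_group (ball_stab x)"
  unfolding ball_stab_def by (rule perm_group_stab[OF G_group])

lemma perm_group_ball_stab_Int: "perm_group (ball_stab x \<inter> ball_stab y)"
  using perm_group_stab[OF perm_group_ball_stab[of x], of "insert y (nbr y)"]
  by (rule back_subst[of perm_group]) (auto simp: ball_stab_def)

lemma arc_stab_commute: "arc_stab x y = arc_stab y x"
  by (auto simp: arc_stab_def)

lemma arc_stab_nbr:
  assumes "g \<in> arc_stab x y"
  shows "g ` (nbr x - {y}) \<subseteq> nbr x - {y}"
proof -
  have g: "g \<in> G" "g x = x" "g y = y" using assms by (auto simp: arc_stab_def)
  have "g z \<noteq> y" if "z \<noteq> y" for z using G_bij[OF g(1)] g(3) that by (metis bij_Inv(2))
  then show ?thesis using nbr_image_iff[OF g(1), of _ x] g by auto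
qed

text \<open>Each further power by the local exponent \<open>c\<close> fixes one more neighbourhood.
  It is used with \<open>c\<close> equal to 1, 2 and 6.\<close>

lemma arc_stab_power_trivial:
  assumes c: "\<And>x y h z. (x, y) \<in> A \<Longrightarrow> h \<in> arc_stab x y \<Longrightarrow> z \<in> nbr x \<Longrightarrow> (h ^^ c) z = z"
    and vw: "(v, w) \<in> A" "g \<in> arc_stab v w"
  shows "\<exists>N. g ^^ (c ^ N) = id"
proof -
  have "\<exists>N. g ^^ (c ^ N) \<in> {id}"
  proof (rule stabilizer_tower[where \<Phi> = "\<lambda>K. \<exists>N. g ^^ (c ^ N) \<in> K" and K = "arc_stab v w"])
    show "\<exists>N. g ^^ (c ^ N) \<in> arc_stab v w" by (rule exI[of _ 0]) (use vw in simp)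
    fix K x y assume K: "perm_group K" "K \<subseteq> arc_stab x y" "(x, y) \<in> A" "\<exists>N. g ^^ (c ^ N) \<in> K"
    then obtain N where N: "g ^^ (c ^ N) \<in> K" by blast
    have e: "g ^^ (c ^ Suc N) = (g ^^ (c ^ N)) ^^ c" by (simp add: funpow_mult' mult.commute)
    have "g ^^ (c ^ Suc N) \<in> K" unfolding e using perm_group_funpow[OF K(1) N] .
    moreover have "\<forall>z\<in>nbr x. (g ^^ (c ^ Suc N)) z = z"
      unfolding e using c[OF K(3)] N K(2) by blast
    ultimately show "\<exists>N. g ^^ (c ^ N) \<in> {k \<in> K. \<forall>z\<in>nbr x. k z = z}" by blast
  qed (use vw perm_group_arc_stab in \<open>auto simp: arc_stab_def\<close>)
  then show ?thesis by simp
qed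

end

section \<open>Permutations induced on a set of edges\<close>

definition act_on :: "'a set set \<Rightarrow> ('a \<Rightarrow> 'a) \<Rightarrow> 'a set \<Rightarrow> 'a set" where
  "act_on E g x = (if x \<in> E then g ` x else x)"

lemma act_on_comp: "(\<And>x. x \<in> E \<Longrightarrow> g ` x \<in> E) \<Longrightarrow> act_on E (f \<circ> g) = act_on E f \<circ> act_on E g"
  by (auto simp: act_on_def fun_eq_iff image_comp)

lemma act_on_id: "act_on E id = id"
  by (auto simp: act_on_def fun_eq_iff)

lemma act_on_perm_group:
  assumes K: "perm_group K" and E: "\<And>k x. k \<in> K \<Longrightarrow> x \<in> E \<Longrightarrow> k ` x \<in> E"
  shows "perm_group (act_on E ` K)" "k \<in> K \<Longrightarrow> act_on E k permutes E"
    "k \<in> K \<Longrightarrow> Inv (act_on E k) = act_on E (Inv k)"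
proof -
  have comp: "act_on E (f \<circ> g) = act_on E f \<circ> act_on E g" if "g \<in> K" for f g
    using that E by (intro act_on_comp)
  have inv: "act_on E k \<circ> act_on E (Inv k) = id" "act_on E (Inv k) \<circ> act_on E k = id" if "k \<in> K" for k
    using that comp[of "Inv k" k] comp[of k "Inv k"] perm_groupD[OF K] by (simp_all add: act_on_id)
  have bij: "bij (act_on E k)" if "k \<in> K" for k
    using inv[OF that] by (intro o_bij)
  have Inv: "Inv (act_on E k) = act_on E (Inv k)" if "k \<in> K" for k
    using inv[OF that] bij[OF that] by (auto simp: fun_eq_iff Inv_eq_iff)
  then show "k \<in> K \<Longrightarrow> Inv (act_on E k) = act_on E (Inv k)" .
  show "act_on E k permutes E" if "k \<in> K"
    using bij[OF that] by (auto simp: permutes_def bij_iff act_on_def)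
  show "perm_group (act_on E ` K)"
    unfolding perm_group_def
  proof (intro conjI ballI)
    show "id \<in> act_on E ` K" using perm_groupD(1)[OF K] act_on_id[of E] by force
    fix f g assume f: "f \<in> act_on E ` K"
    then show "bij f" "Inv f \<in> act_on E ` K" using bij Inv perm_groupD(3)[OF K] by auto
    assume "g \<in> act_on E ` K"
    then obtain f' g' where fg: "f = act_on E f'" "g = act_on E g'" "f' \<in> K" "g' \<in> K" using f by blast
    then have "f \<circ> g = act_on E (f' \<circ> g')" using comp by simp
    then show "f \<circ> g \<in> act_on E ` K" using fg perm_groupD(2)[OF K] by blast
  qed
qed

context arc_transitive_group
begin

text \<open>Alternating groups of degree \<open>n \<ge> 5\<close> are not sections of the symmetric group of degree
  \<open>n - 1\<close>, so the alternating group survives in the kernel of the action on a neighbourhood.\<close>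

lemma cyc3_survive:
  assumes K: "perm_group K" "K \<subseteq> arc_stab x y" "(x, y) \<in> A"
    and E: "finite E" "5 \<le> card E" "card (nbr x) \<le> card E"
    and KE: "\<And>k x. k \<in> K \<Longrightarrow> x \<in> E \<Longrightarrow> k ` x \<in> E"
    and cyc: "\<And>a b c. {a, b, c} \<subseteq> E \<Longrightarrow> distinct [a, b, c] \<Longrightarrow> cyc3 a b c \<in> act_on E ` K"
    and abc: "{a, b, c} \<subseteq> E" "distinct [a, b, c]"
  shows "cyc3 a b c \<in> act_on E ` {k \<in> K. \<forall>z\<in>nbr x. k z = z}"
proof -
  let ?K = "{k \<in> K. \<forall>z\<in>nbr x. k z = z}"
  let ?I = "act_on E ` K" and ?N = "act_on E ` ?K"
  note I = act_on_perm_group[OF K(1) KE]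
  have K': "perm_group ?K" by (rule perm_group_stab[OF K(1)])
  have comp: "act_on E (f \<circ> g) = act_on E f \<circ> act_on E g" if "g \<in> K" for f g
    using that KE by (intro act_on_comp)
  have bij: "bij k" if "k \<in> K" for k using perm_groupD(4)[OF K(1) that] .
  have nb: "k z \<in> nbr x \<longleftrightarrow> z \<in> nbr x" if "k \<in> K" for k z
    using that K(2) nbr_image_iff[of k z x] by (auto simp: arc_stab_def)
  have normal: "normal_sub ?N ?I"
    unfolding normal_sub_def
  proof (intro conjI ballI)
    show "perm_group ?N" by (rule act_on_perm_group(1)[OF K']) (use KE in auto)
    show "?N \<subseteq> ?I" by auto
    fix g h assume "g \<in> ?I" "h \<in> ?N"
    then obtain g' h' where gh: "g' \<in> K" "g = act_on E g'" "h' \<in> ?K" "h = act_on E h'" by auto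
    have "g \<circ> h \<circ> Inv g = act_on E (g' \<circ> h' \<circ> Inv g')"
      using gh perm_groupD(3)[OF K(1) gh(1)] by (simp add: I(3) comp)
    moreover have "g' \<circ> h' \<circ> Inv g' \<in> ?K"
    proof -
      have "(g' \<circ> h' \<circ> Inv g') z = z" if "z \<in> nbr x" for z
        using that gh bij[OF gh(1)] nb[OF perm_groupD(3)[OF K(1) gh(1)], of z] by simp
      then show ?thesis using gh perm_group_conj[OF K(1)] by blast
    qed
    ultimately show "g \<circ> h \<circ> Inv g \<in> ?N" by blast
  qed
  have "\<exists>s\<in>?N. s \<noteq> id"
  proof (rule ccontr)
    assume "\<not> ?thesis"
    then have triv: "act_on E k = id" if "k \<in> ?K" for k using that by blast
    let ?F = "nbr x - {y}"
    \<comment> \<open>If the kernel acts trivially on \<open>E\<close>, then the action of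
      \<open>k\<close> on \<open>E\<close> depends only on its action on the neighbours of
      \<open>x\<close> other than the fixed vertex \<open>y\<close>: elements with equal
      \<open>\<psi>\<close> differ by a kernel element. This bounds the order of \<open>?I\<close>
      by the factorial of \<open>card E - 1\<close>.\<close>
    define \<psi> where "\<psi> k = (\<lambda>z. if z \<in> ?F then k z else z)" for k :: "'a \<Rightarrow> 'a"
    have finF: "finite ?F" using finite_nbr by simp
    have perm: "\<psi> k permutes ?F" if k: "k \<in> K" for k
    proof (rule bij_imp_permutes)
      have sub: "k ` ?F \<subseteq> ?F" using arc_stab_nbr k K(2) by blast
      have inj: "inj_on k ?F" using bij[OF k] by (auto intro: inj_on_subset bij_is_inj)
      have "k ` ?F = ?F" using endo_inj_surj[OF finF sub inj] .
      then have "bij_betw k ?F ?F" using inj by (simp add: bij_betw_def)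
      then show "bij_betw (\<psi> k) ?F ?F" by (rule bij_betw_cong[THEN iffD1, rotated]) (simp add: \<psi>_def)
    qed (auto simp: \<psi>_def)
    have same: "act_on E k = act_on E l" if kl: "k \<in> K" "l \<in> K" "\<psi> k = \<psi> l" for k l
    proof -
      have "k z = l z" if "z \<in> nbr x" for z
      proof (cases "z = y")
        case True
        then have "k z = z" "l z = z" using kl K(2) by (auto simp: arc_stab_def)
        then show ?thesis by simp
      next
        case False
        then show ?thesis using that fun_cong[OF kl(3), of z] by (simp add: \<psi>_def)
      qed
      then have "Inv l \<circ> k \<in> ?K" using kl perm_groupD[OF K(1)] bij[OF kl(2)] by simp
      then have "act_on E (Inv l \<circ> k) = id" by (rule triv)
      then have "act_on E l \<circ> (act_on E (Inv l) \<circ> act_on E k) = act_on E l" using comp[OF kl(1)] by simp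
      moreover have "act_on E l \<circ> act_on E (Inv l) = id"
        using comp[OF perm_groupD(3)[OF K(1) kl(2)], of l] bij[OF kl(2)] by (simp add: act_on_id)
      ultimately show ?thesis by (simp add: o_assoc)
    qed
    have fin: "finite (\<psi> ` K)"
      by (rule finite_subset[OF _ finite_permutations[OF finF]]) (use perm in auto)
    have "?I \<subseteq> (\<lambda>q. act_on E (inv_into K \<psi> q)) ` \<psi> ` K"
    proof
      fix f assume "f \<in> ?I"
      then obtain k where k: "k \<in> K" "f = act_on E k" by blast
      have "f = act_on E (inv_into K \<psi> (\<psi> k))"
        using same[OF k(1), of "inv_into K \<psi> (\<psi> k)"] k
        by (simp add: inv_into_into f_inv_into_f)
      then show "f \<in> (\<lambda>q. act_on E (inv_into K \<psi> q)) ` \<psi> ` K" using k(1) by blast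
    qed
    then have "card ?I \<le> card (\<psi> ` K)" using fin surj_card_le by blast
    also have "\<dots> \<le> card {p. p permutes ?F}"
      by (intro card_mono finite_permutations finF) (use perm in auto)
    also have "\<dots> = fact (card ?F)" using finF by (simp add: card_permutations)
    also have "\<dots> \<le> fact (card E - 1)"
      using E(3) K(3) finite_nbr by (intro fact_mono) (auto simp: nbr_def)
    \<comment> \<open>With n = \<open>card E\<close>, the bounds combine to n! <= 2 (n-1)!, which
      fails for n >= 5.\<close>
    finally have "card ?I \<le> fact (card E - 1)" .
    moreover have "(fact (card E) :: nat) \<le> 2 * card ?I"
      by (rule fact_card_le_two_card_cyc3[OF I(1) _ cyc E(1)]) (use I(2) E(2) in auto)
    moreover have "(fact (card E) :: nat) = card E * fact (card E - 1)"
      using E(2) fact_reduce[of "card E", where ?'a = nat] by simp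
    moreover have "card E * (fact (card E - 1) :: nat) \<ge> 5 * fact (card E - 1)"
      using E(2) by (intro mult_right_mono) auto
    moreover have "(fact (card E - 1) :: nat) > 0" by simp
    ultimately show False by linarith
  qed
  then obtain s where "s \<in> ?N" "s \<noteq> id" by blast
  then show ?thesis
    by (intro normal_sub_all_cyc3[OF I(1) _ cyc normal _ _ E(1,2) abc]) (use I(2) in auto)
qed

end

section \<open>Commuting p-elements and derived subgroups\<close>

lemma p_elem_Inv:
  assumes "bij f" "p_elem p f"
  shows "p_elem p (Inv f)"
proof -
  have "(Inv f ^^ n) ((f ^^ n) x) = x" for n x
    by (induction n) (use assms in \<open>auto simp: funpow_swap1[of "Inv f"]\<close>)
  then have "Inv f ^^ n \<circ> f ^^ n = id" for n by (simp add: fun_eq_iff)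
  then show ?thesis using assms(2) unfolding p_elem_def by (metis comp_id)
qed

lemma p_elem_comp_commute:
  assumes "f \<circ> g = g \<circ> f" "p_elem p f" "p_elem p g"
  shows "p_elem p (f \<circ> g)"
proof -
  obtain k l where kl: "f ^^ (p ^ k) = id" "g ^^ (p ^ l) = id" using assms by (auto simp: p_elem_def)
  have pow: "h ^^ (a * b) = id" if "h ^^ a = id" for h :: "'a \<Rightarrow> 'a" and a b
    using that by (simp flip: funpow_mult' add: id_def fun_eq_iff funpow_fix)
  have fg: "f (g x) = g (f x)" for x using fun_cong[OF assms(1)] by simp
  have com: "(f ^^ n) (g x) = g ((f ^^ n) x)" for n x
    by (induction n) (auto simp: fg)
  have "((f \<circ> g) ^^ n) x = (f ^^ n) ((g ^^ n) x)" for n x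
    by (induction n) (auto simp: com)
  then have "(f \<circ> g) ^^ (p ^ k * p ^ l) = f ^^ (p ^ k * p ^ l) \<circ> g ^^ (p ^ k * p ^ l)"
    by (simp add: fun_eq_iff)
  also have "\<dots> = id" using pow[OF kl(1), of "p ^ l"] pow[OF kl(2), of "p ^ k"] by (simp add: mult.commute)
  finally show ?thesis unfolding p_elem_def by (metis power_add)
qed

text \<open>For a group \<open>N\<close> this is its derived subgroup. As an intersection it comes
  with an induction principle, \<open>commutator_subgroup_least\<close>: a property that defines a
  subgroup need only be checked on commutators.\<close>

definition commutator_subgroup :: "('a \<Rightarrow> 'a) set \<Rightarrow> ('a \<Rightarrow> 'a) set" where
  "commutator_subgroup N = \<Inter>{S. perm_group S \<and> S \<subseteq> N \<and> (\<forall>f\<in>N. \<forall>g\<in>N. commut f g \<in> S)}"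

lemma commutator_subgroup_least:
  "perm_group S \<Longrightarrow> S \<subseteq> N \<Longrightarrow> (\<And>f g. f \<in> N \<Longrightarrow> g \<in> N \<Longrightarrow> commut f g \<in> S) \<Longrightarrow> commutator_subgroup N \<subseteq> S"
  by (auto simp: commutator_subgroup_def)

lemma commut_conj:
  assumes "bij r" "bij f" "bij g"
  shows "r \<circ> commut f g \<circ> Inv r = commut (r \<circ> f \<circ> Inv r) (r \<circ> g \<circ> Inv r)"
  using assms by (simp add: commut_def conj_Inv) (simp add: fun_eq_iff)

lemma commutator_subgroup_normal_sub:
  assumes L: "perm_group L" and N: "normal_sub N L"
  shows "normal_sub (commutator_subgroup N) L" "commutator_subgroup N \<subseteq> N"
    "\<And>f g. f \<in> N \<Longrightarrow> g \<in> N \<Longrightarrow> commut f g \<in> commutator_subgroup N"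
proof -
  have N': "perm_group N" "N \<subseteq> L" "\<And>g h. g \<in> L \<Longrightarrow> h \<in> N \<Longrightarrow> g \<circ> h \<circ> Inv g \<in> N"
    using N by (auto simp: normal_sub_def)
  show com: "commut f g \<in> commutator_subgroup N" if "f \<in> N" "g \<in> N" for f g
    using that by (auto simp: commutator_subgroup_def)
  show sub: "commutator_subgroup N \<subseteq> N" by (rule commutator_subgroup_least[OF N'(1)]) (auto intro: perm_group_commut[OF N'(1)])
  have grp: "perm_group (commutator_subgroup N)"
    by (rule perm_group_subset[OF N'(1) _ sub]) (auto simp: commutator_subgroup_def perm_groupD)
  have "g \<circ> h \<circ> Inv g \<in> commutator_subgroup N" if g: "g \<in> L" and h: "h \<in> commutator_subgroup N" for g h
  proof -
    \<comment> \<open>The elements whose conjugate by \<open>g\<close> stays in the derived subgroup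
      form a subgroup that contains all commutators.\<close>
    let ?S = "{k \<in> N. g \<circ> k \<circ> Inv g \<in> commutator_subgroup N}"
    have bg: "bij g" using perm_groupD(4)[OF L g] .
    have bN: "bij k" if "k \<in> N" for k using perm_groupD(4)[OF N'(1) that] .
    have "perm_group ?S"
    proof (rule perm_group_subset[OF N'(1)])
      show "id \<in> ?S" using perm_groupD(1)[OF N'(1)] perm_groupD(1)[OF grp] bg by simp
      show "a \<circ> b \<in> ?S" if ab: "a \<in> ?S" "b \<in> ?S" for a b
      proof -
        have "(g \<circ> a \<circ> Inv g) \<circ> (g \<circ> b \<circ> Inv g) \<in> commutator_subgroup N"
          using ab perm_groupD(2)[OF grp] by blast
        then show ?thesis using ab perm_groupD(2)[OF N'(1)] unfolding conj_comp[OF bg] by blast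
      qed
      show "Inv a \<in> ?S" if a: "a \<in> ?S" for a
      proof -
        have "Inv (g \<circ> a \<circ> Inv g) \<in> commutator_subgroup N" using a perm_groupD(3)[OF grp] by blast
        moreover have "Inv (g \<circ> a \<circ> Inv g) = g \<circ> Inv a \<circ> Inv g" using conj_Inv[OF bg] bN a by blast
        ultimately show ?thesis using a perm_groupD(3)[OF N'(1)] by simp
      qed
    qed auto
    then have "commutator_subgroup N \<subseteq> ?S"
    proof (rule commutator_subgroup_least)
      fix a b assume ab: "a \<in> N" "b \<in> N"
      then show "commut a b \<in> ?S"
        using com[of "g \<circ> a \<circ> Inv g" "g \<circ> b \<circ> Inv g"] N'(3)[OF g] commut_conj[OF bg bN bN]
          perm_group_commut[OF N'(1)] by auto
    qed auto
    then show ?thesis using h by blast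
  qed
  then show "normal_sub (commutator_subgroup N) L" using grp sub N'(2) by (auto simp: normal_sub_def)
qed

section \<open>Conjugates and p-cores of stabilizers\<close>

context arc_transitive_group
begin

lemma arc_stab_conj_image:
  assumes g: "g \<in> G"
  shows "(\<lambda>h. g \<circ> h \<circ> Inv g) ` arc_stab x y = arc_stab (g x) (g y)"
proof
  have bg: "bij g" using G_bij[OF g] .
  show "(\<lambda>h. g \<circ> h \<circ> Inv g) ` arc_stab x y \<subseteq> arc_stab (g x) (g y)"
    using perm_group_conj[OF G_group g] bg by (auto simp: arc_stab_def simp del: o_apply) auto
  show "arc_stab (g x) (g y) \<subseteq> (\<lambda>h. g \<circ> h \<circ> Inv g) ` arc_stab x y"
  proof
    fix h assume h: "h \<in> arc_stab (g x) (g y)"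
    have "h = g \<circ> (Inv g \<circ> h \<circ> g) \<circ> Inv g" using bg by (simp add: fun_eq_iff)
    moreover have "Inv g \<circ> h \<circ> g \<in> arc_stab x y"
      using h g bg perm_groupD(2,3)[OF G_group] by (simp add: arc_stab_def)
    ultimately show "h \<in> (\<lambda>h. g \<circ> h \<circ> Inv g) ` arc_stab x y" by blast
  qed
qed

lemma ball_stab_conj_image:
  assumes g: "g \<in> G"
  shows "(\<lambda>h. g \<circ> h \<circ> Inv g) ` ball_stab x = ball_stab (g x)"
proof
  have bg: "bij g" using G_bij[OF g] .
  show "(\<lambda>h. g \<circ> h \<circ> Inv g) ` ball_stab x \<subseteq> ball_stab (g x)"
  proof
    fix k assume "k \<in> (\<lambda>h. g \<circ> h \<circ> Inv g) ` ball_stab x"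
    then obtain h where h: "h \<in> ball_stab x" "k = g \<circ> h \<circ> Inv g" by blast
    have "k z = z" if z: "z \<in> insert (g x) (nbr (g x))" for z
    proof -
      have "Inv g z \<in> insert x (nbr x)" using z nbr_image_iff[OF g, of "Inv g z" x] bg by auto
      then have "h (Inv g z) = Inv g z" using h(1) unfolding ball_stab_def by blast
      then show ?thesis using h(2) bg by simp
    qed
    moreover have "k \<in> G" using h perm_group_conj[OF G_group g] by (simp add: ball_stab_def)
    ultimately show "k \<in> ball_stab (g x)" by (simp add: ball_stab_def)
  qed
  show "ball_stab (g x) \<subseteq> (\<lambda>h. g \<circ> h \<circ> Inv g) ` ball_stab x"
  proof
    fix h assume h: "h \<in> ball_stab (g x)"
    have "h = g \<circ> (Inv g \<circ> h \<circ> g) \<circ> Inv g" using bg by (simp add: fun_eq_iff)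
    moreover have "Inv g \<circ> h \<circ> g \<in> ball_stab x"
      using h g bg perm_groupD(2,3)[OF G_group] nbr_image_iff[OF g] by (auto simp: ball_stab_def)
    ultimately show "h \<in> (\<lambda>h. g \<circ> h \<circ> Inv g) ` ball_stab x" by blast
  qed
qed

lemma ball_stab_subset: "(x, y) \<in> A \<Longrightarrow> ball_stab x \<subseteq> arc_stab x y"
  by (auto simp: ball_stab_def arc_stab_def nbr_def)

lemma ball_stab_conj:
  assumes "g \<in> G" "h \<in> ball_stab x"
  shows "g \<circ> h \<circ> Inv g \<in> ball_stab (g x)"
  using ball_stab_conj_image[OF assms(1), of x] assms(2) by blast

text \<open>Under \<open>sub\<close> the p-core of \<open>arc_stab x y\<close> is a normal
  p-subgroup of \<open>ball_stab x\<close>, hence inside the p-core of \<open>ball_stab x\<close>.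
  The latter is invariant under all elements of \<open>G\<close> fixing \<open>x\<close>, so it lies
  in the p-core of \<open>arc_stab x z\<close> for every neighbour \<open>z\<close>. The p-cores can
  thus be carried along walks.\<close>

lemma p_core_arc_stab_trivial:
  assumes sub: "\<And>v w. (v, w) \<in> A \<Longrightarrow> p_core p (arc_stab v w) \<subseteq> ball_stab v"
    and vw: "(v, w) \<in> A" "f \<in> p_core p (arc_stab v w)"
  shows "f = id"
proof (rule arc_family_trivial[where R = "\<lambda>x y. p_core p (arc_stab x y)", OF vw])
  fix x y assume xy: "(x, y) \<in> A"
  show "p_core p (arc_stab x y) \<subseteq> arc_stab x y"
    using normal_sub_p_core[OF perm_group_arc_stab] by (auto simp: normal_sub_def)
  show "p_core p (arc_stab x y) \<subseteq> p_core p (arc_stab y x)" by (simp add: arc_stab_commute)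
  fix z assume xz: "(x, z) \<in> A"
  have n: "normal_sub (p_core p (arc_stab x y)) (arc_stab x y)"
    by (rule normal_sub_p_core[OF perm_group_arc_stab])
  then have "normal_sub (p_core p (arc_stab x y)) (ball_stab x)"
    using ball_stab_subset[OF xy] sub[OF xy] by (auto simp: normal_sub_def)
  then have 1: "p_core p (arc_stab x y) \<subseteq> p_core p (ball_stab x)"
    by (rule p_core_greatest) (rule p_core_p_elem)
  have n': "normal_sub (p_core p (ball_stab x)) (ball_stab x)"
    by (rule normal_sub_p_core[OF perm_group_ball_stab])
  have "normal_sub (p_core p (ball_stab x)) (arc_stab x z)"
    unfolding normal_sub_def
  proof (intro conjI ballI)
    show "perm_group (p_core p (ball_stab x))" using n' by (simp add: normal_sub_def)
    show "p_core p (ball_stab x) \<subseteq> arc_stab x z"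
      using n' ball_stab_subset[OF xz] by (auto simp: normal_sub_def)
    fix g h assume gh: "g \<in> arc_stab x z" "h \<in> p_core p (ball_stab x)"
    then have g: "g \<in> G" "g x = x" by (auto simp: arc_stab_def)
    show "g \<circ> h \<circ> Inv g \<in> p_core p (ball_stab x)"
      using p_core_conj[OF G_bij[OF g(1)] perm_group_ball_stab gh(2)]
      unfolding ball_stab_conj_image[OF g(1)] g(2) .
  qed
  then have "p_core p (ball_stab x) \<subseteq> p_core p (arc_stab x z)"
    by (rule p_core_greatest) (rule p_core_p_elem)
  with 1 show "p_core p (arc_stab x y) \<subseteq> p_core p (arc_stab x z)" by blast
qed

end

section \<open>The Thompson--Wielandt theorem in valency four\<close>

text \<open>The element in \<open>rotation\<close> acts as a three-cycle on the neighbours of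
  \<open>x\<close> other than \<open>y\<close>. Arc stabilizers are then transitive on the three
  possible continuations of an arc, which explains the name.\<close>

locale tetravalent_two_arc = arc_transitive_group +
  assumes card_nbr: "x \<in> V \<Longrightarrow> card (nbr x) = 4"
    and rotation: "\<exists>x y h z. (x, y) \<in> A \<and> h \<in> arc_stab x y \<and> z \<in> nbr x \<and> h (h z) \<noteq> z"
begin

lemma card_nbr_minus: "(x, y) \<in> A \<Longrightarrow> card (nbr x - {y}) = 3"
  using card_nbr[of x] A_subset finite_nbr[of x] by (auto simp: nbr_def)

lemma arc_rotation:
  assumes vw: "(v, w) \<in> A"
  shows "\<exists>h\<in>arc_stab v w. \<exists>z\<in>nbr v - {w}. h (h z) \<noteq> z"
proof -
  obtain x y h z where xy: "(x, y) \<in> A" "h \<in> arc_stab x y" "z \<in> nbr x" "h (h z) \<noteq> z"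
    using rotation by blast
  obtain g where g: "g \<in> G" "g x = v" "g y = w" using G_transitive[OF xy(1) vw] by blast
  have bg: "bij g" using G_bij[OF g(1)] .
  let ?h = "g \<circ> h \<circ> Inv g"
  have h: "?h \<in> arc_stab v w" using arc_stab_conj_image[OF g(1), of x y] xy(2) g by blast
  have "g (h (h z)) \<noteq> g z" using xy(4) bg by (metis bij_Inv(2))
  then have ne: "?h (?h (g z)) \<noteq> g z" using bg by simp
  have "g z \<in> nbr v" using nbr_image_iff[OF g(1), of z x] xy(3) g(2) by simp
  moreover have "?h w = w" using h unfolding arc_stab_def by blast
  then have "g z \<noteq> w" using ne by metis
  ultimately show ?thesis using h ne by blast
qed

lemma arc_stab_bij: "g \<in> arc_stab x y \<Longrightarrow> bij g"
  by (auto simp: arc_stab_def G_bij)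

lemma arc_stab_power_six:
  assumes "(x, y) \<in> A" "h \<in> arc_stab x y" "z \<in> nbr x"
  shows "(h ^^ 6) z = z"
proof (cases "z = y")
  case True
  then show ?thesis using assms(2) by (auto simp: arc_stab_def intro: funpow_fix)
next
  case False
  then have z: "z \<in> nbr x - {y}" using assms(3) by auto
  have 6: "h ^^ 6 = h \<circ> h \<circ> h \<circ> h \<circ> h \<circ> h" by (simp add: eval_nat_numeral o_assoc)
  have "h (h z) = z \<or> h (h (h z)) = z"
    using perm3_order[OF card_nbr_minus[OF assms(1)] arc_stab_nbr[OF assms(2)] arc_stab_bij[OF assms(2)]] z
    by blast
  then show ?thesis unfolding 6 by auto
qed

lemma arc_stab_six_power_trivial:
  "(v, w) \<in> A \<Longrightarrow> g \<in> arc_stab v w \<Longrightarrow> \<exists>N. g ^^ (6 ^ N) = id"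
  using arc_stab_power_trivial[of 6] arc_stab_power_six by blast

lemma p_core_arc_stab:
  "p_core p (arc_stab v w) \<subseteq> arc_stab v w" "perm_group (p_core p (arc_stab v w))"
  "g \<in> arc_stab v w \<Longrightarrow> h \<in> p_core p (arc_stab v w) \<Longrightarrow> g \<circ> h \<circ> Inv g \<in> p_core p (arc_stab v w)"
  using normal_sub_p_core[OF perm_group_arc_stab, of p v w] by (auto simp: normal_sub_def)

lemma ball_stabI:
  assumes "r \<in> arc_stab v w" "\<And>z. z \<in> nbr v - {w} \<Longrightarrow> r z = z"
  shows "r \<in> ball_stab v"
  using assms unfolding ball_stab_def arc_stab_def by blast

text \<open>Let \<open>g\<close> rotate the three other neighbours and let \<open>r\<close> lie in
  the 2-core. Their commutator lies in the 2-core and has trivial cube on three points, so it acts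
  trivially: \<open>r\<close> commutes with a rotation there, is locally a power of it, and being a
  2-element is locally trivial.\<close>

lemma p_core_two_trivial:
  assumes "(v, w) \<in> A" "f \<in> p_core 2 (arc_stab v w)"
  shows "f = id"
proof (rule p_core_arc_stab_trivial[OF _ assms])
  fix v w assume vw: "(v, w) \<in> A"
  let ?F = "nbr v - {w}"
  have F: "card ?F = 3" by (rule card_nbr_minus[OF vw])
  obtain g z where g: "g \<in> arc_stab v w" "z \<in> ?F" "g (g z) \<noteq> z" using arc_rotation[OF vw] by blast
  have gF: "g ` ?F \<subseteq> ?F" and bg: "bij g" using arc_stab_nbr[OF g(1)] arc_stab_bij[OF g(1)] .
  note tr = perm3_transitive[OF F gF bg g(2) g(3)]
  show "p_core 2 (arc_stab v w) \<subseteq> ball_stab v"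
  proof
    fix r assume r: "r \<in> p_core 2 (arc_stab v w)"
    then have ra: "r \<in> arc_stab v w" using p_core_arc_stab(1) by blast
    have rF: "r ` ?F \<subseteq> ?F" and br: "bij r" using arc_stab_nbr[OF ra] arc_stab_bij[OF ra] .
    let ?t = "commut r g"
    have "?t = r \<circ> (g \<circ> Inv r \<circ> Inv g)" by (simp add: commut_def o_assoc)
    then have t: "?t \<in> p_core 2 (arc_stab v w)"
      using perm_groupD(2,3)[OF p_core_arc_stab(2)] p_core_arc_stab(3)[OF g(1)] r by metis
    have fix2: "f x = x" if "f \<in> p_core 2 (arc_stab v w)" "f (f (f x)) = x" for f x
      using p_elem_fix[OF p_core_p_elem[OF that(1)], of 3 x] that(2) by (simp add: eval_nat_numeral)
    have com: "r (g y) = g (r y)" if y: "y \<in> ?F" for y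
    proof -
      have x: "g (r y) \<in> ?F" using y rF gF by blast
      have "?t (g (r y)) = g (r y)"
        using fix2[OF t] perm3_commut_cube[OF F rF br gF bg x] by blast
      then show ?thesis using br bg by (simp add: commut_def)
    qed
    have gz: "g z \<in> ?F" "g (g z) \<in> ?F" using g(2) gF by blast+
    have "r z \<in> {z, g z, g (g z)}" using tr(1) rF g(2) by blast
    then have "r (r (r z)) = z"
      using com[OF g(2)] com[OF gz(1)] com[OF gz(2)] tr(2) by auto
    then have rz: "r z = z" using fix2[OF r] by blast
    have "r y = y" if "y \<in> ?F" for y
      using tr(1)[OF that] rz com[OF g(2)] com[OF gz(1)] by auto
    then show "r \<in> ball_stab v" by (rule ball_stabI[OF ra])
  qed
qed

text \<open>If \<open>r\<close> lies in a normal 3-subgroup of the stabilizer of \<open>(v, w)\<close>, then \<open>r y r\<^sup>-\<^sup>1\<close> differs from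
  \<open>y\<close> by a 3-element normalizing the kernel attached to \<open>{u, v}\<close>; being a 2-element, it stays in
  that kernel.\<close>

lemma two_elem_conj_core:
  assumes vw: "(v, w) \<in> A" and vu: "(v, u) \<in> A" and r: "r \<in> p_core 3 (arc_stab v w)"
    and y: "y \<in> ball_stab v \<inter> ball_stab u" "p_elem 2 y"
  shows "r \<circ> y \<circ> Inv r \<in> ball_stab v \<inter> ball_stab u"
proof -
  let ?X = "ball_stab v \<inter> ball_stab u"
  have X: "perm_group ?X" by (rule perm_group_ball_stab_Int)
  have ra: "r \<in> arc_stab v w" using r p_core_arc_stab(1) by blast
  then have rG: "r \<in> G" "r v = v" by (auto simp: arc_stab_def)
  have br: "bij r" using G_bij[OF rG(1)] .
  have yv: "y \<in> ball_stab v" using y by blast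
  have ya: "y \<in> arc_stab v w" using ball_stab_subset[OF vw] yv by blast
  have by': "bij y" using arc_stab_bij[OF ya] .
  let ?z = "r \<circ> y \<circ> Inv r"
  have zv: "?z \<in> ball_stab v" using ball_stab_conj[OF rG(1) yv] rG(2) by simp
  \<comment> \<open>This commutator of \<open>r\<close> and \<open>y\<close> has two readings. As
    bracketed, it lies in the 3-core because \<open>y\<close> normalizes that core. As
    \<open>?z \<circ> Inv y\<close>, it lies in \<open>ball_stab v\<close>, so it fixes
    \<open>u\<close> and normalizes \<open>?X\<close>.\<close>
  define r1 where "r1 = r \<circ> (y \<circ> Inv r \<circ> Inv y)"
  have z: "?z = r1 \<circ> y" using by' by (simp add: r1_def fun_eq_iff)
  have r1c: "r1 \<in> p_core 3 (arc_stab v w)"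
    unfolding r1_def using perm_groupD(2,3)[OF p_core_arc_stab(2)] p_core_arc_stab(3)[OF ya] r by blast
  have "r1 = ?z \<circ> Inv y" by (simp add: r1_def o_assoc)
  then have "r1 \<in> ball_stab v"
    using perm_groupD(2,3)[OF perm_group_ball_stab] zv yv by metis
  then have "r1 \<in> arc_stab v u" using ball_stab_subset[OF vu] by blast
  then have r1G: "r1 \<in> G" "r1 v = v" "r1 u = u" by (auto simp: arc_stab_def)
  have norm: "r1 \<circ> h \<circ> Inv r1 \<in> ?X" if "h \<in> ?X" for h
    using that ball_stab_conj[OF r1G(1), of h v] ball_stab_conj[OF r1G(1), of h u] r1G(2,3) by simp
  obtain k where k: "r1 ^^ (3 ^ k) = id" using p_core_p_elem[OF r1c] by (auto simp: p_elem_def)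
  obtain h where "h \<in> ?X" "(r1 \<circ> y) ^^ (3 ^ k) = h \<circ> r1 ^^ (3 ^ k)"
    using funpow_comp_normalized[OF X y(1) G_bij[OF r1G(1)] norm] by blast
  then have "?z ^^ (3 ^ k) \<in> ?X" using k z by simp
  then show ?thesis
    using p_elem_in_group[OF X p_elem_conj[OF br y(2)]] by simp
qed

text \<open>The preceding lemma for \<open>Inv r\<close> puts the conjugate of \<open>y\<close> by
  \<open>Inv r\<close> into \<open>ball_stab u\<close>; conjugating back by \<open>r\<close> moves
  \<open>u\<close> to \<open>r u\<close>.\<close>

lemma two_elem_core_orbit:
  assumes vw: "(v, w) \<in> A" and vu: "(v, u) \<in> A" and r: "r \<in> p_core 3 (arc_stab v w)"
    and y: "y \<in> ball_stab v \<inter> ball_stab u" "p_elem 2 y"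
  shows "y \<in> ball_stab v \<inter> ball_stab (r u)"
proof -
  have ra: "r \<in> arc_stab v w" using r p_core_arc_stab(1) by blast
  then have rG: "r \<in> G" "r v = v" by (auto simp: arc_stab_def)
  have br: "bij r" using G_bij[OF rG(1)] .
  have "Inv r \<in> p_core 3 (arc_stab v w)" using perm_groupD(3)[OF p_core_arc_stab(2) r] .
  from two_elem_conj_core[OF vw vu this y]
  have "Inv r \<circ> y \<circ> Inv (Inv r) \<in> ball_stab u" by blast
  from ball_stab_conj[OF rG(1) this]
  have "r \<circ> (Inv r \<circ> y \<circ> Inv (Inv r)) \<circ> Inv r \<in> ball_stab (r u)" .
  moreover have "r \<circ> (Inv r \<circ> y \<circ> Inv (Inv r)) \<circ> Inv r = y" using br by (simp add: fun_eq_iff)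
  ultimately show ?thesis using y(1) by simp
qed

text \<open>A minimal normal subgroup is abelian or perfect. A perfect one acts trivially on every
  neighbourhood, as symmetric groups of degree three are soluble.\<close>

lemma arc_stab_trivial_if_p_cores_trivial:
  assumes vw: "(v, w) \<in> A" and triv: "p_core 2 (arc_stab v w) = {id}" "p_core 3 (arc_stab v w) = {id}"
  shows "arc_stab v w = {id}"
proof (rule ccontr)
  let ?L = "arc_stab v w"
  assume nt: "?L \<noteq> {id}"
  have L: "perm_group ?L" by (rule perm_group_arc_stab)
  have "normal_sub ?L ?L" using L perm_group_conj[OF L] by (auto simp: normal_sub_def)
  then obtain N where N: "normal_sub N ?L" "N \<noteq> {id}"
    and min: "\<And>N'. normal_sub N' ?L \<Longrightarrow> N' \<noteq> {id} \<Longrightarrow> card N \<le> card N'"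
    using ex_has_least_nat[of "\<lambda>N. normal_sub N ?L \<and> N \<noteq> {id}" ?L card] nt by blast
  have N': "perm_group N" "N \<subseteq> ?L" "\<And>g h. g \<in> ?L \<Longrightarrow> h \<in> N \<Longrightarrow> g \<circ> h \<circ> Inv g \<in> N"
    using N(1) by (auto simp: normal_sub_def)
  have bN: "bij f" if "f \<in> N" for f using perm_groupD(4)[OF N'(1) that] .
  have finN: "finite N"
    by (rule finite_subset[OF _ finite_permutations[OF finite_V]])
      (use N'(2) G_permutes in \<open>auto simp: arc_stab_def\<close>)
  note D = commutator_subgroup_normal_sub[OF L N(1)]
  show False
  proof (cases "commutator_subgroup N = {id}")
    case True
    have comm: "f \<circ> g = g \<circ> f" if "f \<in> N" "g \<in> N" for f g
    proof -
      have "commut f g = id" using D(3)[OF that] True by blast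
      then have "commut f g (g (f x)) = g (f x)" for x by simp
      then show ?thesis using bN that by (simp add: commut_def fun_eq_iff)
    qed
    \<comment> \<open>In the abelian group \<open>N\<close> the p-elements form a subgroup; it is
      invariant under conjugation by \<open>?L\<close>, so it lies in the p-core.\<close>
    have "f = id" if f: "f \<in> N" "p_elem p f" and p: "p_core p ?L = {id}" for f p
    proof -
      have "normal_sub {f \<in> N. p_elem p f} ?L"
        unfolding normal_sub_def
      proof (intro conjI ballI)
        show "perm_group {f \<in> N. p_elem p f}"
          by (rule perm_group_subset[OF N'(1)])
            (auto simp: perm_groupD[OF N'(1)] p_elem_Inv bN comm p_elem_comp_commute,
             auto simp: p_elem_def)
        show "{f \<in> N. p_elem p f} \<subseteq> ?L" using N'(2) by blast
        fix g h assume "g \<in> ?L" "h \<in> {f \<in> N. p_elem p f}"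
        then show "g \<circ> h \<circ> Inv g \<in> {f \<in> N. p_elem p f}"
          using N'(3) p_elem_conj arc_stab_bij by blast
      qed
      then have "{f \<in> N. p_elem p f} \<subseteq> p_core p ?L" by (rule p_core_greatest) blast
      then show ?thesis using f p by blast
    qed
    note p_triv = this
    have "f = id" if f: "f \<in> N" for f
    proof -
      obtain k where k: "f ^^ (6 ^ k) = id" using arc_stab_six_power_trivial[OF vw] f N'(2) by blast
      \<comment> \<open>The 2-part of \<open>f\<close> is removed first; what remains is a
        3-element.\<close>
      have "(6 :: nat) ^ k = 3 ^ k * 2 ^ k" by (simp flip: power_mult_distrib)
      then have "(f ^^ (3 ^ k)) ^^ (2 ^ k) = id" using k by (simp add: funpow_mult')
      then have "p_elem 2 (f ^^ (3 ^ k))" by (auto simp: p_elem_def)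
      then have "f ^^ (3 ^ k) = id"
        using p_triv[OF perm_group_funpow[OF N'(1) f] _ triv(1)] by blast
      then have "p_elem 3 f" by (auto simp: p_elem_def)
      then show ?thesis using p_triv[OF f _ triv(2)] by blast
    qed
    then show False using N(2) perm_groupD(1)[OF N'(1)] by blast
  next
    case False
    have perfect: "commutator_subgroup N = N"
      using card_seteq[OF finN D(2) min[OF D(1) False]] .
    have "N \<subseteq> {id}"
    proof (rule stabilizer_tower[where \<Phi> = "\<lambda>K. N \<subseteq> K" and K = ?L])
      fix K x y assume K: "perm_group K" "K \<subseteq> arc_stab x y" "(x, y) \<in> A" "N \<subseteq> K"
      let ?F = "nbr x - {y}"
      have F: "card ?F = 3" by (rule card_nbr_minus[OF K(3)])
      have NF: "f ` ?F \<subseteq> ?F" if "f \<in> N" for f using arc_stab_nbr that K(2,4) by blast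
      have NF': "f z \<in> ?F" if "f \<in> N" "z \<in> ?F" for f z using NF that by blast
      \<comment> \<open>Perfectness is used twice, once for each layer of the symmetric group of
        degree three: first all of \<open>N\<close> acts with trivial cube on
        \<open>?F\<close>.\<close>
      let ?S = "{f \<in> N. \<forall>z\<in>?F. f (f (f z)) = z}"
      have "commutator_subgroup N \<subseteq> ?S"
      proof (rule commutator_subgroup_least)
        show "perm_group ?S"
        proof (rule perm_group_subset[OF N'(1)])
          show "f \<circ> g \<in> ?S" if fg: "f \<in> ?S" "g \<in> ?S" for f g
          proof -
            have "f (g (f (g (f (g z))))) = z" if z: "z \<in> ?F" for z
              using fg z perm3_cube_closed(2)[OF F NF bN NF bN, of f g z] by blast
            then show ?thesis using fg perm_groupD(2)[OF N'(1)] by simp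
          qed
          show "Inv f \<in> ?S" if f: "f \<in> ?S" for f
          proof -
            have "Inv f (Inv f (Inv f z)) = z" if z: "z \<in> ?F" for z
            proof -
              have "f (f (f z)) = z" using f z by blast
              then have "Inv f (Inv f (Inv f z)) = Inv f (Inv f (Inv f (f (f (f z)))))" by simp
              also have "\<dots> = z" using bN f by simp
              finally show ?thesis .
            qed
            then show ?thesis using f perm_groupD(3)[OF N'(1)] by simp
          qed
        qed (use perm_groupD(1)[OF N'(1)] in auto)
        fix f g assume fg: "f \<in> N" "g \<in> N"
        have "commut f g (commut f g (commut f g z)) = z" if "z \<in> ?F" for z
          using perm3_commut_cube[OF F NF[OF fg(1)] bN[OF fg(1)] NF[OF fg(2)] bN[OF fg(2)] that] .
        then show "commut f g \<in> ?S" using perm_group_commut[OF N'(1) fg] by blast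
      qed blast
      then have cube: "f (f (f z)) = z" if "f \<in> N" "z \<in> ?F" for f z using that perfect by blast
      \<comment> \<open>Now \<open>N\<close> acts on \<open>?F\<close> through the abelian
        alternating group of degree three, so its commutators act trivially.\<close>
      have "commutator_subgroup N \<subseteq> {f \<in> N. \<forall>z\<in>?F. f z = z}"
      proof (rule commutator_subgroup_least)
        show "perm_group {f \<in> N. \<forall>z\<in>?F. f z = z}" by (rule perm_group_stab[OF N'(1)])
        fix f g assume fg: "f \<in> N" "g \<in> N"
        have "commut f g z = z" if z: "z \<in> ?F" for z
        proof -
          define u where "u = Inv f (Inv g z)"
          have u: "u \<in> ?F" using NF' z perm_groupD(3)[OF N'(1)] fg unfolding u_def by blast
          have "f (g u) = g (f u)"
            using perm3_cube_closed(1)[OF F NF[OF fg(1)] bN[OF fg(1)] NF[OF fg(2)] bN[OF fg(2)]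
                cube[OF fg(1)] cube[OF fg(2)] u] .
          then show ?thesis using bN[OF fg(1)] bN[OF fg(2)] by (simp add: commut_def u_def)
        qed
        then show "commut f g \<in> {f \<in> N. \<forall>z\<in>?F. f z = z}" using perm_group_commut[OF N'(1) fg] by blast
      qed blast
      then have "f z = z" if "f \<in> N" "z \<in> ?F" for f z using that perfect by blast
      moreover have "f y = y" if "f \<in> N" for f using that K(2,4) by (auto simp: arc_stab_def)
      ultimately show "N \<subseteq> {k \<in> K. \<forall>z\<in>nbr x. k z = z}" using K(4) by blast
    qed (use L vw N'(2) in \<open>auto simp: arc_stab_def\<close>)
    then show False using N(2) perm_groupD(1)[OF N'(1)] by blast
  qed
qed

text \<open>If 3-cores of arc stabilizers always act trivially on the neighbourhood, then both
  p-cores vanish and arc stabilizers are trivial. Otherwise, by arc-transitivity, every 3-core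
  contains a rotation, and \<open>two_elem_core_orbit\<close> passes the 2-elements attached to one
  edge at \<open>v\<close> on to the other edges at \<open>v\<close>.\<close>

theorem two_elem_ball_stab_trivial:
  assumes vw: "(v, w) \<in> A" and f: "f \<in> ball_stab v \<inter> ball_stab w" "p_elem 2 f"
  shows "f = id"
proof (cases "\<forall>v w. (v, w) \<in> A \<longrightarrow> p_core 3 (arc_stab v w) \<subseteq> ball_stab v")
  case True
  have triv: "p_core 2 (arc_stab v w) = {id}" "p_core 3 (arc_stab v w) = {id}"
    using p_core_two_trivial[OF vw] p_core_arc_stab_trivial[OF _ vw, of 3] True
      perm_groupD(1)[OF p_core_arc_stab(2)] by blast+
  have "arc_stab v w = {id}" by (rule arc_stab_trivial_if_p_cores_trivial[OF vw triv])
  then show ?thesis using ball_stab_subset[OF vw] f(1) by blast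
next
  case False
  then obtain x y r where xy: "(x, y) \<in> A" "r \<in> p_core 3 (arc_stab x y)" "r \<notin> ball_stab x" by blast
  have "r \<in> arc_stab x y" using xy(2) p_core_arc_stab(1) by blast
  then obtain z where z: "z \<in> nbr x - {y}" "r z \<noteq> z" using ball_stabI xy(3) by blast
  have core: "\<exists>r\<in>p_core 3 (arc_stab v w). \<exists>z\<in>nbr v - {w}. r z \<noteq> z" if vw: "(v, w) \<in> A" for v w
  proof -
    obtain g where g: "g \<in> G" "g x = v" "g y = w" using G_transitive[OF xy(1) vw] by blast
    have bg: "bij g" using G_bij[OF g(1)] .
    have 1: "g \<circ> r \<circ> Inv g \<in> p_core 3 (arc_stab v w)"
      using p_core_conj[OF bg perm_group_arc_stab xy(2)] unfolding arc_stab_conj_image[OF g(1)] g(2,3) .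
    have inj: "g a = g b \<longleftrightarrow> a = b" for a b using bg by (metis bij_Inv(2))
    have "g z \<in> nbr v - {w}"
      using nbr_image_iff[OF g(1), of z x] g(2,3) inj[of z y] z(1) by auto
    moreover have "(g \<circ> r \<circ> Inv g) (g z) \<noteq> g z" using z(2) bg inj by simp
    ultimately show ?thesis using 1 by blast
  qed
  show ?thesis
  proof (rule arc_family_trivial[where R = "\<lambda>x y. {f \<in> ball_stab x \<inter> ball_stab y. p_elem 2 f}", OF vw])
    show "f \<in> {f \<in> ball_stab v \<inter> ball_stab w. p_elem 2 f}" using f by blast
    fix v u assume vu: "(v, u) \<in> A"
    show "{f \<in> ball_stab v \<inter> ball_stab u. p_elem 2 f} \<subseteq> {f \<in> ball_stab u \<inter> ball_stab v. p_elem 2 f}" by blast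
    show "{f \<in> ball_stab v \<inter> ball_stab u. p_elem 2 f} \<subseteq> arc_stab v u" using ball_stab_subset[OF vu] by blast
    fix u' assume vu': "(v, u') \<in> A"
    \<comment> \<open>Valency four leaves a neighbour \<open>w\<close> different from
      \<open>u\<close> and \<open>u'\<close>. The rotation in the 3-core of
      \<open>arc_stab v w\<close> then permutes cyclically three neighbours including
      \<open>u\<close> and \<open>u'\<close>.\<close>
    have "card (nbr v - {u, u'}) \<ge> 2"
      using card_Diff_insert[of u' "nbr v - {u}"] card_nbr_minus[OF vu] diff_card_le_card_Diff[of "{u'}" "nbr v - {u}"]
      by (simp add: Diff_insert2[symmetric])
    then obtain w where w: "w \<in> nbr v" "w \<noteq> u" "w \<noteq> u'" by (metis DiffE Diff_iff card.empty ex_in_conv insertCI not_numeral_le_zero)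
    then have vw: "(v, w) \<in> A" by (simp add: nbr_def)
    let ?F = "nbr v - {w}"
    have F: "card ?F = 3" by (rule card_nbr_minus[OF vw])
    obtain r z where r: "r \<in> p_core 3 (arc_stab v w)" "z \<in> ?F" "r z \<noteq> z" using core[OF vw] by blast
    have ra: "r \<in> arc_stab v w" using r(1) p_core_arc_stab(1) by blast
    have rF: "r ` ?F \<subseteq> ?F" and br: "bij r" using arc_stab_nbr[OF ra] arc_stab_bij[OF ra] .
    have "r (r z) \<noteq> z"
      using p_elem_fix[OF p_core_p_elem[OF r(1)], of 2 z] r(3) by (auto simp: eval_nat_numeral)
    note tr = perm3_transitive[OF F rF br r(2) this]
    show "{f \<in> ball_stab v \<inter> ball_stab u. p_elem 2 f} \<subseteq> {f \<in> ball_stab v \<inter> ball_stab u'. p_elem 2 f}"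
    proof
      fix f assume f: "f \<in> {f \<in> ball_stab v \<inter> ball_stab u. p_elem 2 f}"
      have step: "f \<in> ball_stab v \<inter> ball_stab (r a)" if "f \<in> ball_stab v \<inter> ball_stab a" "a \<in> ?F" for a
        using two_elem_core_orbit[OF vw _ r(1) that(1)] that(2) f by (auto simp: nbr_def)
      have in_F: "z \<in> ?F" "r z \<in> ?F" "r (r z) \<in> ?F" using r(2) rF by blast+
      have "u \<in> ?F" "u' \<in> ?F" using vu vu' w by (auto simp: nbr_def)
      then have "u \<in> {z, r z, r (r z)}" "u' \<in> {z, r z, r (r z)}" using tr(1) by blast+
      moreover have "f \<in> ball_stab v \<inter> ball_stab u" using f by blast
      ultimately have "f \<in> ball_stab v \<inter> ball_stab u'"
        using step[OF _ in_F(1)] step[OF _ in_F(2)] step[OF _ in_F(3)] tr(2) by (metis insertE singletonD)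
      then show "f \<in> {f \<in> ball_stab v \<inter> ball_stab u'. p_elem 2 f}" using f by blast
    qed
  qed
qed

end

section \<open>Permutable matchings\<close>

lemma image_funpow: "(g ^^ n) ` x = (((`) g) ^^ n) x" for g :: "'a \<Rightarrow> 'a"
proof (induction n)
  case (Suc n)
  have "(g ^^ Suc n) ` x = g ` ((g ^^ n) ` x)" by (simp only: funpow.simps image_comp)
  then show ?case using Suc by simp
qed simp

lemma Inv_image: "bij g \<Longrightarrow> g ` x = y \<Longrightarrow> Inv g ` y = x"
  by (auto simp: image_comp)

locale permutable_matching_graph = arc_transitive_group +
  fixes M :: "'a set set"
  assumes finite_M: "finite M"
    and M_edge: "e \<in> M \<Longrightarrow> \<exists>u v. (u, v) \<in> A \<and> e = {u, v}"
    and M_disjoint: "e \<in> M \<Longrightarrow> e' \<in> M \<Longrightarrow> e \<noteq> e' \<Longrightarrow> e \<inter> e' = {}"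
    and M_permutable: "p permutes M \<Longrightarrow> \<exists>g\<in>G. \<forall>e\<in>M. g ` e = p e"
begin

text \<open>Squaring an element that induces the inverse three-cycle removes a possible swap of \<open>v\<close>
  and \<open>w\<close>.\<close>

lemma arc_stab_cyc3:
  assumes vw: "{v, w} \<in> M" and abc: "{a, b, c} \<subseteq> M - {{v, w}}" "distinct [a, b, c]"
  shows "\<exists>g\<in>arc_stab v w. \<forall>x\<in>M. g ` x = cyc3 a b c x"
proof -
  let ?p = "cyc3 c b a"
  have "?p permutes M" using abc by (intro cyc3_permutes) auto
  from M_permutable[OF this] obtain h where h: "h \<in> G" "\<And>x. x \<in> M \<Longrightarrow> h ` x = ?p x" by metis
  have pM: "?p x \<in> M" if "x \<in> M" for x using that abc by (auto simp: cyc3_def)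
  have "{v, w} \<noteq> a" "{v, w} \<noteq> b" "{v, w} \<noteq> c" using abc(1) by blast+
  then have "?p {v, w} = {v, w}" by (simp add: cyc3_def)
  then have "h ` {v, w} = {v, w}" using h(2)[OF vw] by simp
  then have "h v = v \<and> h w = w \<or> h v = w \<and> h w = v" by (auto simp: doubleton_eq_iff)
  then have "(h \<circ> h) v = v" "(h \<circ> h) w = w" by auto
  moreover have "h \<circ> h \<in> G" using perm_groupD(2)[OF G_group h(1) h(1)] .
  moreover have "(h \<circ> h) ` x = cyc3 a b c x" if x: "x \<in> M" for x
  proof -
    have "(h \<circ> h) ` x = ?p (?p x)" using h(2)[OF x] h(2)[OF pM[OF x]] by (simp only: image_comp[symmetric])
    also have "\<dots> = cyc3 a b c x" using abc(2) by (auto simp: cyc3_def)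
    finally show ?thesis .
  qed
  ultimately show ?thesis by (intro bexI[of _ "h \<circ> h"]) (auto simp: arc_stab_def)
qed

lemma degree_ge_matching_large:
  assumes M: "6 \<le> card M" and x: "x \<in> V"
  shows "card M \<le> card (nbr x)"
proof (rule ccontr)
  assume "\<not> card M \<le> card (nbr x)"
  then have deg: "card (nbr y) < card M" if "y \<in> V" for y using card_nbr_eq[OF x that] by simp
  have "M \<noteq> {}" using M by auto
  then obtain e where e: "e \<in> M" by blast
  then obtain v w where vw: "(v, w) \<in> A" "e = {v, w}" using M_edge by blast
  define E where "E = M - {e}"
  have finE: "finite E" using finite_M by (simp add: E_def)
  have cardE: "card E = card M - 1" using e finite_M by (simp add: E_def)
  \<comment> \<open>An element of \<open>arc_stab v w\<close> may move edges of \<open>E\<close> out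
    of \<open>E\<close>; the walk starts from those that do not, so that \<open>act_on E\<close>
    gives permutations.\<close>
  let ?K = "{g \<in> arc_stab v w. \<forall>x\<in>E. g ` x \<in> E}"
  define \<Phi> where "\<Phi> K \<longleftrightarrow> (\<forall>k\<in>K. \<forall>x\<in>E. k ` x \<in> E) \<and>
    (\<forall>a b c. {a, b, c} \<subseteq> E \<longrightarrow> distinct [a, b, c] \<longrightarrow> cyc3 a b c \<in> act_on E ` K)" for K :: "('a \<Rightarrow> 'a) set"
  have "\<Phi> {id}"
  proof (rule stabilizer_tower[where K = ?K and \<Phi> = \<Phi>, OF _ _ vw(1)])
    show "perm_group ?K"
    proof (rule perm_group_subset[OF perm_group_arc_stab])
      show "Inv f \<in> ?K" if f: "f \<in> ?K" for f
      proof -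
        have bf: "bij f" using f by (auto simp: arc_stab_def G_bij)
        have "inj_on ((`) f) E" using bij_is_inj[OF bf] by (auto simp: inj_on_def inj_image_eq_iff)
        then have "(`) f ` E = E"
          using endo_inj_surj[OF finE, of "(`) f"] f by blast
        have "Inv f ` x \<in> E" if "x \<in> E" for x
        proof -
          have "x \<in> (`) f ` E" using that \<open>(`) f ` E = E\<close> by simp
          then obtain y where "x = f ` y" "y \<in> E" by (rule imageE)
          then show ?thesis using Inv_image[OF bf, of y x] by simp
        qed
        then show ?thesis using f perm_groupD(3)[OF perm_group_arc_stab] by blast
      qed
      show "f \<circ> g \<in> ?K" if fg: "f \<in> ?K" "g \<in> ?K" for f g
      proof -
        have "(f \<circ> g) ` x \<in> E" if "x \<in> E" for x
          using fg that unfolding image_comp[symmetric] by blast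
        then show ?thesis using fg perm_groupD(2)[OF perm_group_arc_stab] by blast
      qed
    qed (auto simp: perm_groupD(1)[OF perm_group_arc_stab])
    show "\<Phi> ?K" unfolding \<Phi>_def
    proof (intro conjI allI impI)
      fix a b c assume abc: "{a, b, c} \<subseteq> E" "distinct [a, b, c]"
      have "{v, w} \<in> M" "{a, b, c} \<subseteq> M - {{v, w}}" using e abc(1) unfolding E_def vw(2) .
      from arc_stab_cyc3[OF this abc(2)]
      obtain g where g: "g \<in> arc_stab v w" "\<And>x. x \<in> M \<Longrightarrow> g ` x = cyc3 a b c x" by metis
      have "cyc3 a b c x \<in> E" if "x \<in> E" for x using that abc by (auto simp: cyc3_def)
      then have "g \<in> ?K" using g by (auto simp: E_def)
      moreover have "act_on E g = cyc3 a b c"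
      proof
        fix x
        show "act_on E g x = cyc3 a b c x"
        proof (cases "x \<in> E")
          case True
          then show ?thesis using g(2)[of x] by (simp add: act_on_def E_def)
        next
          case False
          then have "x \<noteq> a" "x \<noteq> b" "x \<noteq> c" using abc(1) by blast+
          then show ?thesis using False by (simp add: act_on_def cyc3_def)
        qed
      qed
      ultimately show "cyc3 a b c \<in> act_on E ` ?K" using image_eqI[of "cyc3 a b c" "act_on E" g ?K] by simp
    qed auto
    fix K x y assume K: "perm_group K" "K \<subseteq> arc_stab x y" "(x, y) \<in> A" "\<Phi> K"
    have "x \<in> V" using K(3) A_subset by auto
    then have d: "card (nbr x) \<le> card E" using deg[of x] cardE by simp
    have KE: "\<And>k x. k \<in> K \<Longrightarrow> x \<in> E \<Longrightarrow> k ` x \<in> E"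
      and cyc: "\<And>a b c. {a, b, c} \<subseteq> E \<Longrightarrow> distinct [a, b, c] \<Longrightarrow> cyc3 a b c \<in> act_on E ` K"
      using K(4) unfolding \<Phi>_def by simp_all
    show "\<Phi> {k \<in> K. \<forall>z\<in>nbr x. k z = z}" unfolding \<Phi>_def
    proof (intro conjI allI impI)
      fix a b c assume abc: "{a, b, c} \<subseteq> E" "distinct [a, b, c]"
      show "cyc3 a b c \<in> act_on E ` {k \<in> K. \<forall>z\<in>nbr x. k z = z}"
        by (rule cyc3_survive[OF K(1-3) finE _ d KE cyc abc]) (use M cardE in auto)
    qed (use KE in auto)
  qed (auto simp: arc_stab_def)
  moreover have "3 \<le> card E" using M cardE by simp
  then obtain T where "T \<subseteq> E" "card T = 3" using obtain_subset_with_card_n[of 3 E] by metis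
  then obtain a b c where abc: "{a, b, c} \<subseteq> E" "distinct [a, b, c]" by (auto simp: card_3_iff)
  \<comment> \<open>At the end of the walk a three-cycle would have to be induced by the
    identity.\<close>
  ultimately have "cyc3 a b c \<in> {id}" by (auto simp: \<Phi>_def act_on_id)
  then have "cyc3 a b c a = a" by simp
  then show False using abc(2) by (simp add: cyc3_simps)
qed

text \<open>Either arc stabilizers act on neighbourhoods with exponent two, and a three-cycle on the
  remaining edges contradicts their 2-power order, or some element rotates three neighbours while
  fixing a fourth. The latter forces degree at least four, leaving only degree four and five
  edges.\<close>

lemma degree_ge_matching_small:
  assumes M: "card M = 4 \<or> card M = 5" and x: "x \<in> V"
  shows "card M \<le> card (nbr x)"
proof (rule ccontr)
  assume "\<not> card M \<le> card (nbr x)"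
  then have deg: "card (nbr y) < card M" if "y \<in> V" for y using card_nbr_eq[OF x that] by simp
  have "M \<noteq> {}" using M by auto
  then obtain e where e: "e \<in> M" by blast
  then obtain v w where vw: "(v, w) \<in> A" "e = {v, w}" using M_edge by blast
  define E where "E = M - {e}"
  have cardE: "card E = card M - 1" using e finite_M by (simp add: E_def)
  have cyc: "\<exists>g\<in>arc_stab v w. \<forall>x\<in>M. g ` x = cyc3 a b c x" if "{a, b, c} \<subseteq> E" "distinct [a, b, c]" for a b c
    using arc_stab_cyc3[of v w a b c] e vw(2) that by (simp add: E_def)
  show False
  proof (cases "\<forall>x y h z. (x, y) \<in> A \<and> h \<in> arc_stab x y \<and> z \<in> nbr x \<longrightarrow> h (h z) = z")
    case True
    have "3 \<le> card E" using M cardE by auto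
    then obtain T where "T \<subseteq> E" "card T = 3" using obtain_subset_with_card_n[of 3 E] by metis
    then obtain a b c where abc: "{a, b, c} \<subseteq> E" "distinct [a, b, c]" by (auto simp: card_3_iff)
    obtain g where g: "g \<in> arc_stab v w" "\<And>x. x \<in> M \<Longrightarrow> g ` x = cyc3 a b c x"
      using cyc[OF abc] by metis
    have "(h ^^ 2) z = z" if "(x, y) \<in> A" "h \<in> arc_stab x y" "z \<in> nbr x" for x y h z
      using True that by (auto simp: eval_nat_numeral)
    \<comment> \<open>A 2-power of \<open>g\<close> is trivial, whereas \<open>g\<close> permutes
      \<open>a\<close>, \<open>b\<close>, \<open>c\<close> cyclically.\<close>
    then obtain N where N: "g ^^ (2 ^ N) = id" using arc_stab_power_trivial[OF _ vw(1) g(1)] by blast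
    have "g ` a = b" "g ` b = c" "g ` c = a"
      using g(2) abc by (auto simp: E_def cyc3_simps)
    then have "(((`) g) ^^ 3) a = a" by (simp add: eval_nat_numeral)
    moreover have "(((`) g) ^^ (2 ^ N)) a = a" using N by (simp flip: image_funpow)
    ultimately have "g ` a = a" using funpow_coprime_fix[of 3 "2 ^ N" "(`) g" a] by simp
    then show False using \<open>g ` a = b\<close> abc(2) by simp
  next
    case False
    then obtain x y h z where xy: "(x, y) \<in> A" "h \<in> arc_stab x y" "z \<in> nbr x" "h (h z) \<noteq> z" by blast
    have xV: "x \<in> V" using xy(1) A_subset by auto
    have hy: "h y = y" "h \<in> G" using xy(2) by (auto simp: arc_stab_def)
    have inj: "h a = h b \<longleftrightarrow> a = b" for a b using G_bij[OF hy(2)] by (metis bij_Inv(2))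
    have zF: "z \<in> nbr x - {y}" using xy(3,4) hy by auto
    then have "h z \<in> nbr x - {y}" "h (h z) \<in> nbr x - {y}" using arc_stab_nbr[OF xy(2)] by blast+
    moreover have "y \<in> nbr x" using xy(1) by (simp add: nbr_def)
    moreover have "h z \<noteq> z" using xy(4) by metis
    moreover from this have "h (h z) \<noteq> h z" using inj[of "h z" z] by simp
    ultimately have "card {y, z, h z, h (h z)} = 4" "{y, z, h z, h (h z)} \<subseteq> nbr x"
      using zF xy(4) by auto
    then have "4 \<le> card (nbr x)" using card_mono[OF finite_nbr] by metis
    then have m5: "card M = 5" and c4: "card (nbr x) = 4" using deg[OF xV] M by auto
    interpret tetravalent_two_arc V A G
      by unfold_locales (use card_nbr_eq[OF xV] c4 xy in auto)
    have "card E = 4" using cardE m5 by simp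
    then have "E \<noteq> {}" by auto
    then obtain a where a: "a \<in> E" by blast
    then have "card (E - {a}) = 3" using \<open>card E = 4\<close> by simp
    then obtain b c d where "E - {a} = {b, c, d}" "distinct [b, c, d]" by (auto simp: card_3_iff)
    moreover from this have "a \<notin> {b, c, d}" by blast
    ultimately have E: "E = {a, b, c, d}" "distinct [a, b, c, d]" using insert_Diff[OF a] by simp_all
    obtain s where s: "s \<in> arc_stab v w" "\<And>x. x \<in> M \<Longrightarrow> s ` x = cyc3 a b c x"
      using cyc[of a b c] E by auto
    obtain t where t: "t \<in> arc_stab v w" "\<And>x. x \<in> M \<Longrightarrow> t ` x = cyc3 b c d x"
      using cyc[of b c d] E by auto
    have bs: "bij s" and bt: "bij t" using arc_stab_bij s t by blast+
    have inM: "a \<in> M" "b \<in> M" "c \<in> M" "d \<in> M" using E(1) by (auto simp: E_def)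
    have sv: "s ` a = b" "s ` b = c" "s ` c = a" "s ` d = d"
      using s(2) inM E(2) by (auto simp: cyc3_def)
    have tv: "t ` a = a" "t ` b = c" "t ` c = d" "t ` d = b"
      using t(2) inM E(2) by (auto simp: cyc3_def)
    \<comment> \<open>\<open>f\<close> induces the double transposition \<open>(a d)(b c)\<close>, but \<open>f ^^ 3\<close> lies in a 3-group.\<close>
    define f where "f = commut s t"
    have fv: "f ` a = d" "f ` d = a"
      using Inv_image[OF bs sv(1)] Inv_image[OF bs sv(2)] Inv_image[OF bs sv(3)] Inv_image[OF bs sv(4)]
        Inv_image[OF bt tv(1)] Inv_image[OF bt tv(2)] Inv_image[OF bt tv(3)] Inv_image[OF bt tv(4)] sv tv
      by (simp_all only: f_def commut_def image_comp[symmetric])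
    have fa: "f \<in> arc_stab v w" unfolding f_def using perm_group_commut[OF perm_group_arc_stab s(1) t(1)] .
    have f3: "f ^^ 3 \<in> arc_stab v w" using perm_group_funpow[OF perm_group_arc_stab fa] .
    \<comment> \<open>Stated for a variable arc because it is needed at both ends, for
      \<open>(v, w)\<close> and for \<open>(w, v)\<close>.\<close>
    have ball: "f ^^ 3 \<in> ball_stab v'" if vw': "(v', w') \<in> A" "arc_stab v w = arc_stab v' w'" for v' w'
    proof (rule ball_stabI)
      show "f ^^ 3 \<in> arc_stab v' w'" using f3 vw'(2) by simp
      fix z assume z: "z \<in> nbr v' - {w'}"
      have "s ` (nbr v' - {w'}) \<subseteq> nbr v' - {w'}" "t ` (nbr v' - {w'}) \<subseteq> nbr v' - {w'}"
        using arc_stab_nbr s(1) t(1) vw'(2) by blast+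
      then show "(f ^^ 3) z = z"
        using perm3_commut_cube[OF card_nbr_minus[OF vw'(1)] _ bs _ bt z]
        by (simp add: f_def eval_nat_numeral)
    qed
    have f3X: "f ^^ 3 \<in> ball_stab v \<inter> ball_stab w"
      using ball[OF vw(1)] ball[OF A_sym[OF vw(1)]] arc_stab_commute by blast
    obtain N where N: "(f ^^ 3) ^^ (6 ^ N) = id" using arc_stab_six_power_trivial[OF vw(1) f3] by blast
    \<comment> \<open>This power leaves only the 2-part of \<open>f ^^ 3\<close>. Once it is
      trivial, \<open>f\<close> has 3-power order, yet it swaps \<open>a\<close> and
      \<open>d\<close>.\<close>
    let ?y = "(f ^^ 3) ^^ (3 ^ N)"
    have "(6 :: nat) ^ N = 3 ^ N * 2 ^ N" by (simp flip: power_mult_distrib)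
    then have "?y ^^ (2 ^ N) = id" using N by (simp add: funpow_mult' mult.assoc)
    then have "p_elem 2 ?y" by (auto simp: p_elem_def)
    moreover have "?y \<in> ball_stab v \<inter> ball_stab w"
      using perm_group_funpow[OF perm_group_ball_stab_Int f3X] .
    ultimately have "?y = id" using two_elem_ball_stab_trivial[OF vw(1)] by blast
    then have "f ^^ (3 ^ Suc N) = id" by (simp add: funpow_mult')
    then have "(((`) f) ^^ (3 ^ Suc N)) a = a" by (simp flip: image_funpow)
    moreover have "(((`) f) ^^ 2) a = a" using fv by (simp add: eval_nat_numeral)
    ultimately have "f ` a = a" using funpow_coprime_fix[of 2 "3 ^ Suc N" "(`) f" a] by simp
    then show False using fv E(2) by simp
  qed
qed

text \<open>A connected graph of valency one is a single edge and has no room for a second, disjoint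
  one.\<close>

lemma degree_ge_two:
  assumes M: "2 \<le> card M" and x: "x \<in> V"
  shows "2 \<le> card (nbr x)"
proof (rule ccontr)
  assume "\<not> 2 \<le> card (nbr x)"
  then have deg: "card (nbr y) \<le> 1" if "y \<in> V" for y using card_nbr_eq[OF x that] by simp
  obtain e e' where e: "e \<in> M" "e' \<in> M" "e \<noteq> e'"
    using card_le_Suc0_iff_eq[OF finite_M] M by fastforce
  obtain v w where vw: "(v, w) \<in> A" "e = {v, w}" using M_edge e by blast
  obtain u z where uz: "(u, z) \<in> A" "e' = {u, z}" using M_edge e by blast
  have V: "v \<in> V" "w \<in> V" "u \<in> V" using vw uz A_subset by auto
  have single: "y \<in> {b}" if "a \<in> V" "b \<in> nbr a" "y \<in> nbr a" for a b y
    using deg[OF that(1)] that card_le_Suc0_iff_eq[OF finite_nbr, of a] by auto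
  have "w \<in> nbr v" "v \<in> nbr w" using vw(1) A_sym by (simp_all add: nbr_def)
  then have "nbr v \<subseteq> {w}" "nbr w \<subseteq> {v}" using single V by blast+
  then have "nbr y \<subseteq> {v, w}" if "y \<in> {v, w}" for y using that by blast
  then have "V \<subseteq> {v, w}" using nbr_closed_imp_V[of v "{v, w}"] V by blast
  then show False using M_disjoint[OF e] V vw(2) uz(2) by auto
qed

lemma degree_less_matching_imp:
  assumes x: "x \<in> V" and "card (nbr x) < card M"
  shows "card M = 3" "card (nbr x) = 2"
proof -
  have "M \<noteq> {}" using assms(2) by auto
  then have "A \<noteq> {}" using M_edge by blast
  then have "card (nbr x) \<noteq> 0" using not_isolated[OF _ x] finite_nbr by auto
  then have "2 \<le> card M" using assms(2) by simp
  then have 2: "2 \<le> card (nbr x)" using degree_ge_two x by blast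
  moreover have "\<not> 6 \<le> card M" using degree_ge_matching_large[OF _ x] assms(2) by auto
  moreover have "\<not> (card M = 4 \<or> card M = 5)" using degree_ge_matching_small[OF _ x] assms(2) by auto
  ultimately show "card M = 3" "card (nbr x) = 2" using assms(2) by linarith+
qed

end

section \<open>Cycles\<close>

context arc_transitive_group
begin

text \<open>Arc-transitivity supplies an element \<open>g\<close> that shifts the path
  \<open>a0\<close>, \<open>a1\<close>, \<open>a2\<close> by one step, so the powers of
  \<open>g\<close> applied to \<open>a0\<close> run around the cycle.\<close>

lemma cycle_enumeration:
  assumes deg: "\<And>x. x \<in> V \<Longrightarrow> card (nbr x) = 2" and ne: "A \<noteq> {}"
  shows "\<exists>a. bij_betw a {..<card V} V \<and>
    (\<forall>i<card V. \<forall>j<card V. (a i, a j) \<in> A \<longleftrightarrow> j = (i + 1) mod card V \<or> i = (j + 1) mod card V)"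
proof -
  obtain a0 a1 where a01: "(a0, a1) \<in> A" using ne by auto
  have a1: "a1 \<in> V" "a0 \<in> V" "a0 \<in> nbr a1" using a01 A_subset A_sym by (auto simp: nbr_def)
  have "card (nbr a1 - {a0}) = 1" using deg[OF a1(1)] a1(3) finite_nbr by simp
  then obtain a2 where "nbr a1 - {a0} = {a2}" by (auto simp: card_1_singleton_iff)
  then have a2: "nbr a1 = {a0, a2}" "a0 \<noteq> a2" using a1(3) by blast+
  then have "(a1, a2) \<in> A" by (auto simp: nbr_def)
  then obtain g where g: "g \<in> G" "g a0 = a1" "g a1 = a2" using G_transitive[OF a01] by blast
  define a where "a i = (g ^^ i) a0" for i
  have powG: "g ^^ i \<in> G" for i by (rule perm_group_funpow[OF G_group g(1)])
  have powinj: "(g ^^ i) x = (g ^^ i) y \<longleftrightarrow> x = y" for i x y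
    using G_bij[OF powG] by (metis bij_Inv(2))
  have aV: "a i \<in> V" for i
    using permutes_in_image[OF G_permutes[OF powG]] a1 by (simp add: a_def)
  have a_add: "a (i + j) = (g ^^ i) (a j)" for i j by (simp add: a_def funpow_add)
  have "a 0 = a0" "a 1 = a1" "a 2 = a2" using g by (simp_all add: a_def eval_nat_numeral)
  then have nbr_Suc: "nbr (a (i + 1)) = {a i, a (i + 2)}" for i
    using nbr_image[OF powG, of i a1] a2 a_add[of i 1] a_add[of i 2] a_add[of i 0] by simp
  have "\<not> inj a" using finite_subset[OF _ finite_V, of "range a"] aV finite_imageD[of a UNIV] infinite_UNIV_nat by blast
  then obtain i j where ij: "a i = a j" "i < j" unfolding inj_def by (metis linorder_neqE_nat)
  then have "a (i + 0) = a (i + (j - i))" by simp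
  then have "a (j - i) = a0" unfolding a_add powinj by (simp add: a_def)
  then have ex: "\<exists>n. 0 < n \<and> a n = a0" using ij(2) by (intro exI[of _ "j - i"]) simp
  define n where "n = (LEAST n. 0 < n \<and> a n = a0)"
  have n: "0 < n" "a n = a0" using LeastI_ex[OF ex] by (auto simp: n_def)
  have n_min: "n \<le> k" if "0 < k" "a k = a0" for k
    unfolding n_def by (rule Least_le) (use that in auto)
  have a_mod: "a (i mod n) = a i" for i
  proof -
    have "(g ^^ n) a0 = a0" using n(2) by (simp add: a_def)
    then have "(g ^^ (n * (i div n))) a0 = a0" by (simp flip: funpow_mult' add: funpow_fix)
    then have "a (i mod n + n * (i div n)) = a (i mod n)" unfolding a_add by (simp add: a_def)
    then show ?thesis by simp
  qed
  have inj': "\<not> a i = a j" if "i < j" "j < n" for i j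
  proof
    assume "a i = a j"
    then have "a (i + 0) = a (i + (j - i))" using that by simp
    then have "a (j - i) = a0" unfolding a_add powinj by (simp add: a_def)
    then show False using n_min[of "j - i"] that by simp
  qed
  have inj: "inj_on a {..<n}"
    by (rule inj_onI) (metis inj' lessThan_iff linorder_neqE_nat)
  have a_eq: "a i = a j \<longleftrightarrow> i mod n = j mod n" for i j
    using inj_onD[OF inj, of "i mod n" "j mod n"] a_mod n(1) by (metis lessThan_iff mod_less_divisor)
  \<comment> \<open>Adding \<open>n - 1\<close> stands for the predecessor modulo \<open>n\<close>,
    which also covers \<open>i = 0\<close> in the natural numbers.\<close>
  have nbr_a: "nbr (a i) = {a (i + (n - 1)), a (i + 1)}" for i
  proof -
    have "a i = a (i + (n - 1) + 1)" "a (i + (n - 1) + 2) = a (i + 1)" using n(1) unfolding a_eq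
      by (simp_all add: mod_simps) (metis add_Suc_right mod_add_self2 plus_1_eq_Suc add.commute Suc_diff_1)
    then show ?thesis using nbr_Suc[of "i + (n - 1)"] by simp
  qed
  have "V \<subseteq> range a"
  proof (rule nbr_closed_imp_V[of "a 0"])
    fix x assume "x \<in> range a"
    then show "nbr x \<subseteq> range a" using nbr_a by auto
  qed (use aV in auto)
  moreover have "range a \<subseteq> a ` {..<n}"
  proof
    fix x assume "x \<in> range a"
    then obtain i where "x = a (i mod n)" using a_mod by auto
    then show "x \<in> a ` {..<n}" using n(1) by simp
  qed
  ultimately have "a ` {..<n} = V" using aV by auto
  then have bij: "bij_betw a {..<n} V" using inj by (simp add: bij_betw_def)
  then have card: "card V = n" using bij_betw_same_card by fastforce
  have "(a i, a j) \<in> A \<longleftrightarrow> j = (i + 1) mod n \<or> i = (j + 1) mod n" if "i < n" "j < n" for i j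
  proof -
    have "(a i, a j) \<in> A \<longleftrightarrow> a j = a (i + (n - 1)) \<or> a j = a (i + 1)"
      using nbr_a[of i] by (auto simp: nbr_def)
    also have "\<dots> \<longleftrightarrow> j = (i + (n - 1)) mod n \<or> j = (i + 1) mod n" unfolding a_eq using that by simp
    also have "j = (i + (n - 1)) mod n \<longleftrightarrow> i = (j + 1) mod n"
    proof (cases "i = 0")
      case True
      then show ?thesis using that by (cases "j + 1 = n") auto
    next
      case False
      then have "i + (n - 1) = (i - 1) + n" using that by simp
      then have "(i + (n - 1)) mod n = i - 1" using that by (simp only: mod_add_self2) simp
      then show ?thesis using that False by (cases "j + 1 = n") auto
    qed
    finally show ?thesis by blast
  qed
  then show ?thesis using bij card by blast
qed

end

context permutable_matching_graph
begin

text \<open>In valency two an automorphism in \<open>G\<close> fixing an arc is trivial. A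
  three-cycle on the edges therefore yields an element of order three without fixed vertices, whose
  orbits split \<open>V\<close> into triples; six vertices are already covered by the
  matching.\<close>

lemma matching_three_card_V:
  assumes M3: "card M = 3" and deg: "\<And>x. x \<in> V \<Longrightarrow> card (nbr x) = 2"
  shows "3 dvd card V" "6 \<le> card V"
proof -
  have triv: "g = id" if g: "g \<in> arc_stab v w" and vw: "(v, w) \<in> A" for g v w
  proof -
    have "(h ^^ 1) z = z" if h: "(x, y) \<in> A" "h \<in> arc_stab x y" "z \<in> nbr x" for x y h z
    proof (cases "z = y")
      case True
      then show ?thesis using h by (auto simp: arc_stab_def)
    next
      case False
      have xy: "x \<in> V" "y \<in> nbr x" using h(1) A_subset by (auto simp: nbr_def)
      then obtain p q where "nbr x = {p, q}" using deg by (meson card_2_iff)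
      then have "nbr x - {y} = {z}" using xy(2) h(3) False by auto
      then show ?thesis using arc_stab_nbr[OF h(2)] by auto
    qed
    then show ?thesis using arc_stab_power_trivial[of 1, OF _ vw g] by auto
  qed
  obtain e1 e2 e3 where M: "M = {e1, e2, e3}" "distinct [e1, e2, e3]" using M3 by (auto simp: card_3_iff)
  have "cyc3 e1 e2 e3 permutes M" using M by (intro cyc3_permutes) auto
  from M_permutable[OF this] obtain h where h: "h \<in> G" "\<And>e. e \<in> M \<Longrightarrow> h ` e = cyc3 e1 e2 e3 e" by metis
  have he: "h ` e1 = e2" "h ` e2 = e3" "h ` e3 = e1" using h(2) M by (auto simp: cyc3_simps)
  obtain v w where vw: "(v, w) \<in> A" "e1 = {v, w}" using M_edge[of e1] M by auto
  have h3e: "(h ^^ 3) ` e1 = e1" unfolding image_funpow using he by (simp add: eval_nat_numeral)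
  then have "(h ^^ 3) ` {v, w} = {v, w}" using vw(2) by simp
  then have "(h ^^ 3) v = v \<and> (h ^^ 3) w = w \<or> (h ^^ 3) v = w \<and> (h ^^ 3) w = v"
    by (auto simp only: image_insert image_empty doubleton_eq_iff)
  moreover have "h ^^ 6 = h ^^ 3 \<circ> h ^^ 3" by (simp flip: funpow_add)
  ultimately have "(h ^^ 6) v = v" "(h ^^ 6) w = w" by auto
  then have h6: "h ^^ 6 = id" using triv[OF _ vw(1)] perm_group_funpow[OF G_group h(1)] by (simp add: arc_stab_def)
  \<comment> \<open>The cube of \<open>h\<close> may still reverse \<open>e1\<close>, so only
    \<open>h ^^ 6\<close> is known to be trivial. As 4 is 1 modulo 3 and 12 is divisible by 6,
    \<open>k\<close> induces the same three-cycle as \<open>h\<close> and has trivial cube.\<close>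
  define k where "k = h ^^ 4"
  have kG: "k \<in> G" unfolding k_def by (rule perm_group_funpow[OF G_group h(1)])
  have "k ^^ 3 = (h ^^ 6) ^^ 2" by (simp add: k_def funpow_mult')
  then have k3: "k ^^ 3 = id" using h6 by simp
  have kkk: "k (k (k x)) = x" for x
  proof -
    have "k (k (k x)) = (k ^^ 3) x" by (simp add: eval_nat_numeral)
    then show ?thesis using k3 by simp
  qed
  have "k ` e1 = e2" unfolding k_def image_funpow using he by (simp add: eval_nat_numeral)
  then have knid: "k \<noteq> id" using M(2) by auto
  have nofix: "k x \<noteq> x" if x: "x \<in> V" for x
  proof
    assume kx: "k x = x"
    obtain p q where pq: "nbr x = {p, q}" "p \<noteq> q" using deg[OF x] by (meson card_2_iff)
    have kn: "k z \<in> {p, q}" if "z \<in> {p, q}" for z using nbr_image_iff[OF kG, of z x] kx pq that by simp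
    have inj: "k z = k z' \<longleftrightarrow> z = z'" for z z' using kkk by metis
    \<comment> \<open>A map with trivial cube cannot swap the two neighbours of
      \<open>x\<close>.\<close>
    have "k p = p"
    proof (rule ccontr)
      assume "k p \<noteq> p"
      then have "k p = q" using kn[of p] by auto
      moreover have "k q = p" using kn[of q] inj[of p q] pq(2) calculation by auto
      ultimately show False using kkk[of p] pq(2) by simp
    qed
    then have "k \<in> arc_stab x p" using kx kG by (simp add: arc_stab_def)
    moreover have "(x, p) \<in> A" using pq(1) by (auto simp: nbr_def)
    ultimately show False using triv knid by blast
  qed
  let ?o = "\<lambda>x. {x, k x, k (k x)}"
  have kV: "k x \<in> V \<longleftrightarrow> x \<in> V" for x using permutes_in_image[OF G_permutes[OF kG]] .
  have "3 dvd card (\<Union> (?o ` V))"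
  proof (rule dvd_partition)
    show "finite (\<Union> (?o ` V))" using finite_V by auto
    show "\<forall>c\<in>?o ` V. 3 dvd card c"
    proof
      fix c assume "c \<in> ?o ` V"
      then obtain x where x: "x \<in> V" "c = ?o x" by blast
      have "k x \<noteq> x" "k (k x) \<noteq> k x" "k (k x) \<noteq> x" using nofix x(1) kV kkk by metis+
      then have "card c = 3" using x(2) by auto
      then show "3 dvd card c" by simp
    qed
    have eq: "?o x = ?o y" if "z \<in> ?o x" "z \<in> ?o y" for x y z
    proof -
      have oz: "?o z = ?o x" if "z \<in> ?o x" for x z
        using that kkk by (elim insertE emptyE) (auto simp: kkk)
      show ?thesis using oz[OF that(1)] oz[OF that(2)] by metis
    qed
    show "\<forall>c1\<in>?o ` V. \<forall>c2\<in>?o ` V. c1 \<noteq> c2 \<longrightarrow> c1 \<inter> c2 = {}"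
    proof (intro ballI impI)
      fix c1 c2 assume c: "c1 \<in> ?o ` V" "c2 \<in> ?o ` V" "c1 \<noteq> c2"
      then obtain x y where "c1 = ?o x" "c2 = ?o y" by blast
      then show "c1 \<inter> c2 = {}" using eq[of _ x y] c(3) by (metis disjoint_iff)
    qed
  qed
  moreover have "\<Union> (?o ` V) = V" using kV by auto
  ultimately show "3 dvd card V" by simp
  have "card (\<Union> M) = sum card M"
    by (rule card_Union_disjoint) (use M_edge M_disjoint in \<open>auto simp: pairwise_def disjnt_def\<close>)
  also have "\<dots> = sum (\<lambda>_. 2) M"
  proof (rule sum.cong)
    fix e assume "e \<in> M"
    then obtain u v where "(u, v) \<in> A" "e = {u, v}" using M_edge by blast
    then show "card e = 2" using A_irrefl by (auto simp: card_insert_if)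
  qed simp
  also have "\<dots> = 6" using M3 by simp
  finally have "card (\<Union> M) = 6" .
  moreover have "\<Union> M \<subseteq> V" using M_edge A_subset by blast
  ultimately show "6 \<le> card V" using card_mono[OF finite_V, of "\<Union> M"] by simp
qed

end

section \<open>Translation from pair digraphs and \<open>AutGraph\<close>\<close>

lemma graph_iso_cycle_graph:
  assumes "pair_wf_digraph \<Gamma>" and a: "bij_betw a {..<n} (pverts \<Gamma>)"
    and adj: "\<And>i j. i < n \<Longrightarrow> j < n \<Longrightarrow>
      (a i, a j) \<in> parcs \<Gamma> \<longleftrightarrow> j = (i + 1) mod n \<or> i = (j + 1) mod n"
  shows "digraph_iso (with_proj \<Gamma>) (with_proj (cycle_graph n))"
proof -
  interpret pair_wf_digraph \<Gamma> by fact
  define b where "b = the_inv_into {..<n} a"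
  have b: "bij_betw b (pverts \<Gamma>) {..<n}" unfolding b_def by (rule bij_betw_the_inv_into[OF a])
  have ab: "a (b x) = x" if "x \<in> pverts \<Gamma>" for x
    using a that by (auto simp: b_def bij_betw_def f_the_inv_into_f)
  have ba: "b (a i) = i" if "i < n" for i
    using a that by (auto simp: b_def bij_betw_def the_inv_into_f_f)
  have bn: "b x < n" if "x \<in> pverts \<Gamma>" for x using b that by (auto simp: bij_betw_def)
  have aV: "a i \<in> pverts \<Gamma>" if "i < n" for i using a that by (auto simp: bij_betw_def)
  \<comment> \<open>The isomorphism leads to the cycle, so vertices are mapped by the inverse of the
    enumeration; arcs are pairs and are mapped componentwise.\<close>
  let ?h = "\<lparr>iso_verts = b, iso_arcs = map_prod b b, iso_head = snd, iso_tail = fst\<rparr>"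
  have inj: "inj_on b (pverts \<Gamma>)" using b by (simp add: bij_betw_def)
  have arcs_sub: "parcs \<Gamma> \<subseteq> pverts \<Gamma> \<times> pverts \<Gamma>"
    using arc_fst_in_verts arc_snd_in_verts by (fastforce simp: mem_Times_iff)
  have "inj_on (map_prod b b) (parcs \<Gamma>)"
    by (rule inj_on_subset[OF map_prod_inj_on[OF inj inj] arcs_sub])
  then have "pre_digraph.digraph_isomorphism (with_proj \<Gamma>) ?h"
    using inj wf_digraph_axioms by (simp add: pre_digraph.digraph_isomorphism_def wf_digraph_wp_iff assms(1))
  moreover have "map_prod b b ` parcs \<Gamma> = parcs (cycle_graph n)"
  proof (intro equalityI subsetI)
    fix p assume "p \<in> map_prod b b ` parcs \<Gamma>"
    then obtain x y where xy: "(x, y) \<in> parcs \<Gamma>" "p = (b x, b y)" by auto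
    then have V: "x \<in> pverts \<Gamma>" "y \<in> pverts \<Gamma>" using arcs_sub by auto
    show "p \<in> parcs (cycle_graph n)"
      using adj[OF bn[OF V(1)] bn[OF V(2)]] xy V bn by (simp add: cycle_graph_def ab)
  next
    fix p assume "p \<in> parcs (cycle_graph n)"
    then obtain i j where ij: "p = (i, j)" "i < n" "j < n" "j = (i + 1) mod n \<or> i = (j + 1) mod n"
      by (auto simp: cycle_graph_def)
    then have "(a i, a j) \<in> parcs \<Gamma>" using adj by blast
    moreover have "p = map_prod b b (a i, a j)" using ij ba by simp
    ultimately show "p \<in> map_prod b b ` parcs \<Gamma>" by blast
  qed
  then have "with_proj (cycle_graph n) = app_iso ?h (with_proj \<Gamma>)"
    using b by (simp add: app_iso_def with_proj_def bij_betw_def cycle_graph_def)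
  ultimately show ?thesis unfolding digraph_iso_def by blast
qed

text \<open>Elements of \<^const>\<open>AutGraph\<close> are undefined outside the vertex set; extending them by the
  identity turns composition of restricted maps into ordinary composition.\<close>

definition extend_id :: "'a set \<Rightarrow> ('a \<Rightarrow> 'a) \<Rightarrow> 'a \<Rightarrow> 'a" where
  "extend_id V g x = (if x \<in> V then g x else x)"

lemma arc_transitive_group_extend:
  fixes \<Gamma> :: "'a pair_pre_digraph"
  assumes "pair_graph \<Gamma>"
    and conn: "Digraph_Component.connected (with_proj \<Gamma>)"
    and sub: "subgroup G (AutGraph \<Gamma>)"
    and trans: "arc_transitive G \<Gamma>"
  shows "arc_transitive_group (pverts \<Gamma>) (parcs \<Gamma>) (extend_id (pverts \<Gamma>) ` G)"
proof -
  interpret pair_graph \<Gamma> by fact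
  let ?V = "pverts \<Gamma>" let ?e = "extend_id (pverts \<Gamma>)"
  have aut: "g \<in> graph_auts \<Gamma>" if "g \<in> G" for g
    using subgroup.subset[OF sub] that by (auto simp: AutGraph_def)
  have Bij: "g \<in> Bij ?V" if "g \<in> G" for g using aut[OF that] by (simp add: graph_auts_def)
  have gV: "g x \<in> ?V" if "g \<in> G" "x \<in> ?V" for g x
    using Bij_imp_funcset[OF Bij[OF that(1)]] that(2) by auto
  have mult: "f \<otimes>\<^bsub>AutGraph \<Gamma>\<^esub> g = compose ?V f g" if "f \<in> G" "g \<in> G" for f g
    using Bij that by (simp add: AutGraph_def BijGroup_def)
  have one: "\<one>\<^bsub>AutGraph \<Gamma>\<^esub> = (\<lambda>x\<in>?V. x)" by (simp add: AutGraph_def BijGroup_def)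
  have e_comp: "?e (compose ?V f g) = ?e f \<circ> ?e g" if "g \<in> G" for f g
    using gV[OF that] by (auto simp: extend_id_def fun_eq_iff compose_eq)
  have e_one: "?e (\<lambda>x\<in>?V. x) = id" by (auto simp: extend_id_def fun_eq_iff)
  have perm: "?e g permutes ?V" if "g \<in> G" for g
  proof (rule bij_imp_permutes)
    have "bij_betw g ?V ?V" using Bij[OF that] by (simp add: Bij_def)
    then show "bij_betw (?e g) ?V ?V"
      by (rule bij_betw_cong[THEN iffD1, rotated]) (simp add: extend_id_def)
  qed (simp add: extend_id_def)
  have group: "Group.group (AutGraph \<Gamma>)" by (rule group_AutGraph)
  \<comment> \<open>The inverse in \<open>AutGraph\<close> extends to a right inverse of the total
    bijection \<open>?e g\<close>, which must be \<open>Inv (?e g)\<close>.\<close>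
  have inv: "Inv (?e g) \<in> ?e ` G" if g: "g \<in> G" for g
  proof -
    let ?i = "m_inv (AutGraph \<Gamma>) g"
    have i: "?i \<in> G" using subgroup.m_inv_closed[OF sub g] .
    have "g \<otimes>\<^bsub>AutGraph \<Gamma>\<^esub> ?i = \<one>\<^bsub>AutGraph \<Gamma>\<^esub>"
      using group.r_inv[OF group] subgroup.subset[OF sub] g by blast
    then have "?e g \<circ> ?e ?i = id" using mult[OF g i] one e_comp[OF i] e_one by metis
    then have "?e g (?e ?i x) = x" for x by (simp add: fun_eq_iff)
    then have "Inv (?e g) = ?e ?i"
      using permutes_bij[OF perm[OF g]] by (simp add: fun_eq_iff Inv_eq_iff)
    then show ?thesis using i by blast
  qed
  have grp: "perm_group (?e ` G)"
    unfolding perm_group_def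
  proof (intro conjI ballI)
    show "id \<in> ?e ` G" using subgroup.one_closed[OF sub] one e_one by (metis image_eqI)
    fix f assume f: "f \<in> ?e ` G"
    then show "Inv f \<in> ?e ` G" "bij f" using inv perm permutes_bij by blast+
    fix g assume "g \<in> ?e ` G"
    then obtain f' g' where fg: "f' \<in> G" "g' \<in> G" "f = ?e f'" "g = ?e g'" using f by blast
    have "compose ?V f' g' \<in> G" using subgroup.m_closed[OF sub fg(1,2)] mult[OF fg(1,2)] by simp
    moreover have "f \<circ> g = ?e (compose ?V f' g')" using e_comp[OF fg(2)] fg by simp
    ultimately show "f \<circ> g \<in> ?e ` G" by blast
  qed
  have arcs_sub: "parcs \<Gamma> \<subseteq> ?V \<times> ?V"
    using arc_fst_in_verts arc_snd_in_verts by (fastforce simp: mem_Times_iff)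
  show ?thesis
  proof
    show "finite ?V" by (rule pair_finite_verts)
    show "parcs \<Gamma> \<subseteq> ?V \<times> ?V" by (rule arcs_sub)
    show "(y, x) \<in> parcs \<Gamma>" if "(x, y) \<in> parcs \<Gamma>" for x y
      using pair_sym_arcs that by (auto simp: symmetric_def elim: symE)
    show "(x, x) \<notin> parcs \<Gamma>" for x using pair_no_loops[of "(x, x)"] by auto
    show "(x, y) \<in> (parcs \<Gamma>)\<^sup>*" if "x \<in> ?V" "y \<in> ?V" for x y
    proof -
      have "strongly_connected (with_proj \<Gamma>)"
        using symmetric_connected_imp_strongly_connected conn pair_sym_arcs by blast
      then have "(x, y) \<in> rtrancl_on ?V (parcs \<Gamma>)"
        using that by (simp add: strongly_connected_def reachable_def)
      then show ?thesis by (rule rtrancl_on_rtranclI)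
    qed
    show "perm_group (?e ` G)" by (rule grp)
    show "g permutes ?V" if "g \<in> ?e ` G" for g using that perm by blast
    show "(g x, g y) \<in> parcs \<Gamma>" if g: "g \<in> ?e ` G" and xy: "(x, y) \<in> parcs \<Gamma>" for g x y
    proof -
      obtain g' where g': "g' \<in> G" "g = ?e g'" using g by blast
      have "x \<in> ?V" "y \<in> ?V" using xy arcs_sub by auto
      then show ?thesis using aut[OF g'(1)] xy g'(2) by (simp add: graph_auts_def extend_id_def)
    qed
    show "\<exists>g\<in>?e ` G. g x = u \<and> g y = v" if xy: "(x, y) \<in> parcs \<Gamma>" and uv: "(u, v) \<in> parcs \<Gamma>" for x y u v
    proof -
      obtain g where g: "g \<in> G" "g x = u" "g y = v"
        using trans xy uv unfolding arc_transitive_def by fast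
      have "x \<in> ?V" "y \<in> ?V" using xy arcs_sub by auto
      then show ?thesis using g by (intro bexI[of _ "?e g"]) (auto simp: extend_id_def)
    qed
  qed
qed

lemma permutable_matching_graph_extend:
  fixes \<Gamma> :: "'a pair_pre_digraph"
  assumes "pair_graph \<Gamma>" "Digraph_Component.connected (with_proj \<Gamma>)" "subgroup G (AutGraph \<Gamma>)"
    "arc_transitive G \<Gamma>" and M: "permutable_matching G \<Gamma> m M"
  shows "permutable_matching_graph (pverts \<Gamma>) (parcs \<Gamma>) (extend_id (pverts \<Gamma>) ` G) M"
proof -
  interpret arc_transitive_group "pverts \<Gamma>" "parcs \<Gamma>" "extend_id (pverts \<Gamma>) ` G"
    by (rule arc_transitive_group_extend[OF assms(1-4)])
  have edge: "\<exists>u v. (u, v) \<in> parcs \<Gamma> \<and> e = {u, v}" if "e \<in> M" for e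
  proof -
    have "e \<in> graph_edges \<Gamma>" using M that unfolding permutable_matching_def matching_def by blast
    then show ?thesis by (auto simp: graph_edges_def)
  qed
  show ?thesis
  proof
    show "finite M" using M by (simp add: permutable_matching_def)
    show "\<exists>u v. (u, v) \<in> parcs \<Gamma> \<and> e = {u, v}" if "e \<in> M" for e using edge[OF that] .
    show "e \<inter> e' = {}" if "e \<in> M" "e' \<in> M" "e \<noteq> e'" for e e'
      using M that by (simp add: permutable_matching_def matching_def)
    fix p assume p: "p permutes M"
    \<comment> \<open>Members of \<open>BijGroup M\<close> are undefined outside \<open>M\<close>,
      while \<open>p\<close> is the identity there.\<close>
    have "restrict p M \<in> Bij M"
      using permutes_imp_bij[OF p] by (simp add: Bij_def bij_betw_restrict_eq)
    then have "restrict p M \<in> (\<lambda>g. \<lambda>e \<in> M. g ` e) ` setwise_stabilizer G M"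
      using M by (simp add: permutable_matching_def BijGroup_def)
    then obtain g where g: "g \<in> G" "restrict p M = (\<lambda>e \<in> M. g ` e)"
      by (auto simp: setwise_stabilizer_def)
    have "extend_id (pverts \<Gamma>) g ` e = p e" if e: "e \<in> M" for e
    proof -
      have "e \<subseteq> pverts \<Gamma>" using edge[OF e] A_subset by auto
      then have "extend_id (pverts \<Gamma>) g ` e = g ` e"
        by (intro image_cong) (auto simp: extend_id_def)
      also have "\<dots> = p e" using fun_cong[OF g(2), of e] e by simp
      finally show ?thesis .
    qed
    then show "\<exists>g\<in>extend_id (pverts \<Gamma>) ` G. \<forall>e\<in>M. g ` e = p e" using g(1) by blast
  qed
qed

theorem theorem1p1:
  fixes \<Gamma> :: "'a pair_pre_digraph" and G :: "('a \<Rightarrow> 'a) set" and m :: nat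
  assumes "pair_graph \<Gamma>"
    and "Digraph_Component.connected (with_proj \<Gamma>)"
    and "subgroup G (AutGraph \<Gamma>)"
    and "arc_transitive G \<Gamma>"
    and "\<exists>M. permutable_matching G \<Gamma> m M"
  shows "(\<forall>v \<in> pverts \<Gamma>. m \<le> out_degree (with_proj \<Gamma>) v) \<or>
    (m = 3 \<and> (\<exists>k \<ge> 2. digraph_iso (with_proj \<Gamma>) (with_proj (cycle_graph (3 * k)))))"
proof -
  obtain M where M: "permutable_matching G \<Gamma> m M" using assms(5) by blast
  interpret permutable_matching_graph "pverts \<Gamma>" "parcs \<Gamma>" "extend_id (pverts \<Gamma>) ` G" M
    by (rule permutable_matching_graph_extend[OF assms(1-4) M])
  have m: "card M = m" using M by (simp add: permutable_matching_def)
  have out: "out_degree (with_proj \<Gamma>) v = card (nbr v)" for v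
  proof -
    have "out_arcs (with_proj \<Gamma>) v = Pair v ` nbr v" by (auto simp: out_arcs_def nbr_def)
    then show ?thesis by (simp add: out_degree_def card_image inj_on_def)
  qed
  show ?thesis
  proof (cases "\<forall>v \<in> pverts \<Gamma>. m \<le> card (nbr v)")
    case False
    then obtain v where v: "v \<in> pverts \<Gamma>" "card (nbr v) < card M" using m by auto
    \<comment> \<open>Degrees agree at all vertices, so a single vertex of small degree makes the
      whole graph 2-valent.\<close>
    have m3: "card M = 3" and deg: "card (nbr x) = 2" if "x \<in> pverts \<Gamma>" for x
      using degree_less_matching_imp[OF v] card_nbr_eq[OF v(1)] that by auto
    have M3: "card M = 3" using m3[OF v(1)] .
    note V = matching_three_card_V[OF M3 deg]
    obtain k where k: "card (pverts \<Gamma>) = 3 * k" using V(1) by blast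
    have "M \<noteq> {}" using M3 by auto
    then have "parcs \<Gamma> \<noteq> {}" using M_edge by blast
    from cycle_enumeration[OF deg this] obtain a
      where a: "bij_betw a {..<3 * k} (pverts \<Gamma>)"
        and adj: "\<And>i j. i < 3 * k \<Longrightarrow> j < 3 * k \<Longrightarrow>
          (a i, a j) \<in> parcs \<Gamma> \<longleftrightarrow> j = (i + 1) mod (3 * k) \<or> i = (j + 1) mod (3 * k)"
      unfolding k by blast
    have "pair_wf_digraph \<Gamma>"
      using assms(1) by (simp add: pair_graph_def pair_digraph_def pair_fin_digraph_def)
    then have "digraph_iso (with_proj \<Gamma>) (with_proj (cycle_graph (3 * k)))"
      using a adj by (rule graph_iso_cycle_graph)
    moreover have "k \<ge> 2" using V(2) k by simp
    ultimately show ?thesis using M3 m by blast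
  qed (simp add: out)
qed

end
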